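(* Let $X$ be a stratified space with a smooth structure $C^\infty(X)$. Let $\{U_i\}_{i\in I}$ be a locally finite open covering of $X$ such that each $U_i$ has a compact closure $\bar U_i$. Then there exists a smooth partition of unity $\{f_i\}_{i\in I}$ (with $f_i\in C^\infty(X)$) subordinate to $\{U_i\}_{i\in I}$.
   Context: Stratified spaces. A decomposed space is a Hausdorff paracompact finite-dimensional topological space $X$ with a locally finite collection of disjoint locally closed (smooth) manifolds $S_i\subset X$ (strata), indexed by a partially ordered set $\mathcal S$, such that $X=\bigcup_i S_i$ and $S_i\cap\bar S_j\ne\emptyset\Leftrightarrow S_i\subset\bar S_j\Leftrightarrow i\le j$. The depth of a stratum $S$ is the supremum of $n$ with strata $S=S_0<S_1<\dots<S_n$; the depth of $X$ is the supremum of the depths of its strata. For a space $L$, $cL=L\times[0,\infty)/L\times\{0\}$, $[z,t]$ is the class of $(z,t)$, and $cL(\varepsilon)=\{[z,t]\in cL: t<\varepsilon\}$. A decomposed space $X$ is a stratified space if (recursively) for each point $x$ in a stratum $S$ there are an open neighborhood $U(x)$ of $x$ in $X$, an open ball $B_x$ around $x$ in $S$, a compact stratified space $L$ (the link) and a homeomorphism $\phi_x:U(x)\to B_x\times cL(1)$ preserving the decompositions. Smooth structures. A subalgebra $C^\infty(X)$ of the algebra $C^0(X)$ of continuous real-valued functions is a $C^\infty$-ring if $G(f_1,\dots,f_n)\in C^\infty(X)$ whenever $f_i\in C^\infty(X)$, $G\in C^\infty(\mathbb R^n)$; it is germ-defined if every function that near each point coincides with an element of $C^\infty(X)$ belongs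 to $C^\infty(X)$. $SC^\infty(X)$ denotes the associated sheaf of functions. The product smooth structure on $Y_1\times Y_2$ is the germ-defined $C^\infty$-ring whose sheaf is generated by $\pi_1^*SC^\infty(Y_1)$ and $\pi_2^*SC^\infty(Y_2)$, i.e. its elements are locally of the form $G(\pi_1^*f_1,\dots,\pi_1^*f_n,\pi_2^*h_1,\dots,\pi_2^*h_k)$ with $G$ smooth, $f_i,h_j$ smooth on $Y_1,Y_2$. A smooth structure on a stratified space $X$ is (recursively on the depth) a choice of an $\mathbb R$-subalgebra $C^\infty(X)\subset C^0(X)$ such that: (1) $C^\infty(X)$ is a germ-defined $C^\infty$-ring; (2) for any $x\in X$ there is a local trivialization $\phi_x:U(x)\to B_x\times cL(1)$ with $C^\infty(U(x))=\phi_x^*(C^\infty(B_x\times cL(1)))$, where $C^\infty(B_x\times cL(1))$ is the product smooth structure of the usual smooth functions on $B_x$ and a smooth structure on $cL(1)$; (3) a smooth structure $C^\infty(cL(1))$ on the cone over a compact stratified space $L$ (with its smooth structure) must satisfy (3a) $C^\infty(cL(1))|_{L\times(0,1)}\subset C^\infty(L\times(0,1))$ (product smooth structure) and (3b) $j_*[\pi_1^*(C^\infty_{u,0}(0,1))]\subset C^\infty(cL(1))$, where $\pi_1:L\times(0,1)\to(0,1)$ is the projection, $C^\infty_{u,0}(0,1)$ is the space of usual smooth compactly supported functions and $j_*$ is extension by zero. *)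

theory Defs
  imports "HOL-Analysis.Analysis"
begin

section \<open>Smooth functions and smooth manifolds\<close>

text \<open>Functions of class \<open>C\<^sup>k\<close> on an open subset \<open>U\<close> of \<open>\<real>\<^sup>n\<close>, where \<open>\<real>\<^sup>n\<close> is the library's
  \<^const>\<open>Euclidean_space\<close> (sequences vanishing from index \<open>n\<close> on), because \<open>n\<close> has to vary.\<close>

primrec C_k_on :: "nat \<Rightarrow> nat \<Rightarrow> (nat \<Rightarrow> real) set \<Rightarrow> ((nat \<Rightarrow> real) \<Rightarrow> real) \<Rightarrow> bool" where
  "C_k_on 0 n U G \<longleftrightarrow> continuous_map (subtopology (Euclidean_space n) U) euclideanreal G"
| "C_k_on (Suc k) n U G \<longleftrightarrow>
     continuous_map (subtopology (Euclidean_space n) U) euclideanreal G \<and>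
     (\<forall>i<n. \<exists>D. (\<forall>x\<in>U. ((\<lambda>t. G (x(i := t))) has_real_derivative D x) (at (x i))) \<and>
                C_k_on k n U D)"

definition smooth_on :: "nat \<Rightarrow> (nat \<Rightarrow> real) set \<Rightarrow> ((nat \<Rightarrow> real) \<Rightarrow> real) \<Rightarrow> bool" where
  "smooth_on n U G \<longleftrightarrow> (\<forall>k. C_k_on k n U G)"

definition smooth_real_on :: "real set \<Rightarrow> (real \<Rightarrow> real) \<Rightarrow> bool" where
  "smooth_real_on T h \<longleftrightarrow> (\<forall>k. \<forall>t\<in>T. (deriv ^^ k) h field_differentiable (at t))"

definition paracompact_space :: "'a topology \<Rightarrow> bool" where
  "paracompact_space X \<longleftrightarrow>
     (\<forall>\<U>. (\<forall>U\<in>\<U>. openin X U) \<and> \<Union>\<U> = topspace X \<longrightarrow>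
        (\<exists>\<V>. (\<forall>V\<in>\<V>. openin X V \<and> (\<exists>U\<in>\<U>. V \<subseteq> U)) \<and> \<Union>\<V> = topspace X \<and>
             locally_finite_in X \<V>))"

type_synonym 'a chart = "'a set \<times> ('a \<Rightarrow> nat \<Rightarrow> real)"

definition is_chart :: "'a topology \<Rightarrow> nat \<Rightarrow> 'a chart \<Rightarrow> bool" where
  "is_chart M n c \<longleftrightarrow> (case c of (V, \<psi>) \<Rightarrow>
     openin M V \<and> openin (Euclidean_space n) (\<psi> ` V) \<and>
     homeomorphic_map (subtopology M V) (subtopology (Euclidean_space n) (\<psi> ` V)) \<psi>)"

definition smooth_transition :: "nat \<Rightarrow> 'a chart \<Rightarrow> 'a chart \<Rightarrow> bool" where
  "smooth_transition n c d \<longleftrightarrow> (case (c, d) of ((V, \<psi>), (W, \<eta>)) \<Rightarrow>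
     (\<forall>i<n. smooth_on n (\<psi> ` (V \<inter> W)) (\<lambda>v. \<eta> (inv_into V \<psi> v) i)))"

text \<open>Paracompactness instead of second countability only admits more manifolds.\<close>

definition smooth_manifold :: "'a topology \<Rightarrow> nat \<Rightarrow> 'a chart set \<Rightarrow> bool" where
  "smooth_manifold M n A \<longleftrightarrow>
     Hausdorff_space M \<and> paracompact_space M \<and>
     (\<forall>c\<in>A. is_chart M n c) \<and> (\<Union>c\<in>A. fst c) = topspace M \<and>
     (\<forall>c\<in>A. \<forall>d\<in>A. smooth_transition n c d)"

definition compatible_chart :: "'a topology \<Rightarrow> nat \<Rightarrow> 'a chart set \<Rightarrow> 'a chart \<Rightarrow> bool" where
  "compatible_chart M n A c \<longleftrightarrow>
     is_chart M n c \<and> (\<forall>d\<in>A. smooth_transition n c d \<and> smooth_transition n d c)"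

definition open_ball_around ::
    "'a topology \<Rightarrow> nat \<Rightarrow> 'a chart set \<Rightarrow> 'a \<Rightarrow> 'a set \<Rightarrow> bool" where
  "open_ball_around M n A x B \<longleftrightarrow>
     x \<in> B \<and>
     (\<exists>\<psi> r. 0 < r \<and> compatible_chart M n A (B, \<psi>) \<and>
            \<psi> ` B = {v \<in> topspace (Euclidean_space n). (\<Sum>i<n. (v i - \<psi> x i)\<^sup>2) < r\<^sup>2})"

text \<open>The usual smooth functions on an open subset \<open>B\<close> of a manifold with atlas \<open>A\<close>. As with all
  algebras of functions below, values outside the space in question are unconstrained.\<close>

definition manifold_smooth_functions :: "nat \<Rightarrow> 'a chart set \<Rightarrow> 'a set \<Rightarrow> ('a \<Rightarrow> real) set" where
  "manifold_smooth_functions n A B =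
     {f. \<forall>(V, \<psi>)\<in>A. smooth_on n (\<psi> ` (V \<inter> B)) (\<lambda>v. f (inv_into V \<psi> v))}"


section \<open>Decomposed spaces and cones\<close>

text \<open>The strata are indexed by themselves. The order of the index set is determined by the strata
  (\<open>S \<le> T\<close> iff \<open>S\<close> lies in the closure of \<open>T\<close>), and nonempty disjoint strata make the indexing
  injective, so this loses nothing. Each stratum carries its dimension and an atlas.\<close>

record 'a decomposition =
  top_of :: "'a topology"
  strata :: "'a set set"
  sdim :: "'a set \<Rightarrow> nat"
  atlas :: "'a set \<Rightarrow> 'a chart set"

definition stratum_order :: "'a decomposition \<Rightarrow> 'a set rel" where
  "stratum_order X =
     {(S, T). S \<in> strata X \<and> T \<in> strata X \<and> S \<subseteq> top_of X closure_of T}"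

definition decomposed_space :: "'a decomposition \<Rightarrow> bool" where
  "decomposed_space X \<longleftrightarrow>
     Hausdorff_space (top_of X) \<and> paracompact_space (top_of X) \<and> (\<exists>n. top_of X dim_le n) \<and>
     \<Union>(strata X) = topspace (top_of X) \<and> pairwise disjnt (strata X) \<and> {} \<notin> strata X \<and>
     locally_finite_in (top_of X) (strata X) \<and>
     (\<forall>S\<in>strata X. (\<exists>P Q. openin (top_of X) P \<and> closedin (top_of X) Q \<and> S = P \<inter> Q) \<and>
        smooth_manifold (subtopology (top_of X) S) (sdim X S) (atlas X S)) \<and>
     partial_order_on (strata X) (stratum_order X) \<and>
     (\<forall>S\<in>strata X. \<forall>T\<in>strata X.
        S \<inter> top_of X closure_of T \<noteq> {} \<longleftrightarrow> (S, T) \<in> stratum_order X)"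

text \<open>Points of the cone are the equivalence classes: \<open>L \<times> {0}\<close> (the vertex) and the singletons
  \<open>{(z, t)}\<close> with \<open>t > 0\<close>. For empty \<open>L\<close> the vertex is the empty set and is still a point, so the
  cone over the empty space is a point, as the local triviality of open strata requires.\<close>

definition cone_vertex :: "'a topology \<Rightarrow> ('a \<times> real) set" where
  "cone_vertex L = topspace L \<times> {0}"

definition cone_class :: "'a topology \<Rightarrow> 'a \<times> real \<Rightarrow> ('a \<times> real) set" where
  "cone_class L p = (if snd p = 0 then cone_vertex L else {p})"

definition cone_below :: "'a topology \<Rightarrow> real \<Rightarrow> ('a \<times> real) set set" where
  "cone_below L \<epsilon> = insert (cone_vertex L) (cone_class L ` (topspace L \<times> {0<..<\<epsilon>}))"

definition cone_points :: "'a topology \<Rightarrow> ('a \<times> real) set set" where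
  "cone_points L = insert (cone_vertex L) (cone_class L ` (topspace L \<times> {0..}))"

text \<open>The quotient topology.\<close>

definition cone_topology :: "'a topology \<Rightarrow> ('a \<times> real) set topology" where
  "cone_topology L = topology (\<lambda>W. W \<subseteq> cone_points L \<and>
     openin (prod_topology L (top_of_set {0..})) {p \<in> topspace L \<times> {0..}. cone_class L p \<in> W})"

lemma openin_cone_topology:
  "openin (cone_topology L) W \<longleftrightarrow> W \<subseteq> cone_points L \<and>
     openin (prod_topology L (top_of_set {0..})) {p \<in> topspace L \<times> {0..}. cone_class L p \<in> W}"
proof -
  let ?P = "prod_topology L (top_of_set {0::real..})"
  let ?pre = "\<lambda>W. {p \<in> topspace L \<times> {0..}. cone_class L p \<in> W}"
  have "istopology (\<lambda>W. W \<subseteq> cone_points L \<and> openin ?P (?pre W))"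
    unfolding istopology_def
  proof (intro conjI allI impI)
    fix S T assume S: "S \<subseteq> cone_points L \<and> openin ?P (?pre S)"
      and T: "T \<subseteq> cone_points L \<and> openin ?P (?pre T)"
    show "S \<inter> T \<subseteq> cone_points L" using S by blast
    have "?pre (S \<inter> T) = ?pre S \<inter> ?pre T" by blast
    then show "openin ?P (?pre (S \<inter> T))" using S T by (simp only: openin_Int)
  next
    fix \<K> assume K: "\<forall>K\<in>\<K>. K \<subseteq> cone_points L \<and> openin ?P (?pre K)"
    show "\<Union>\<K> \<subseteq> cone_points L" using K by blast
    have "?pre (\<Union>\<K>) = \<Union>(?pre ` \<K>)" by blast
    moreover have "openin ?P (\<Union>(?pre ` \<K>))" using K by (intro openin_Union) blast
    ultimately show "openin ?P (?pre (\<Union>\<K>))" by simp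
  qed
  then show ?thesis
    unfolding cone_topology_def by (simp add: topology_inverse')
qed

definition open_cone :: "'a topology \<Rightarrow> real \<Rightarrow> ('a \<times> real) set topology" where
  "open_cone L \<epsilon> = subtopology (cone_topology L) (cone_below L \<epsilon>)"

text \<open>The decomposed space \<open>cL(1)\<close>: the strata are the vertex and \<open>S \<times> (0,1)\<close> for the strata
  \<open>S\<close> of \<open>L\<close>. The stratum \<open>S\<close> is recovered from \<open>T = S \<times> (0,1)\<close>, a set of singletons
  \<open>{(z, t)}\<close>, as \<open>fst ` \<Union>T\<close>; the extra coordinate \<open>t\<close> is put at index \<open>dim S\<close>.\<close>

definition cone_decomposition :: "'a decomposition \<Rightarrow> ('a \<times> real) set decomposition" where
  "cone_decomposition L =
     (let K = top_of L; v = cone_vertex K in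
      \<lparr> top_of = open_cone K 1,
        strata = insert {v} ((\<lambda>S. cone_class K ` (S \<times> {0<..<1})) ` strata L),
        sdim = (\<lambda>T. if T = {v} then 0 else Suc (sdim L (fst ` \<Union>T))),
        atlas = (\<lambda>T. if T = {v} then {({v}, \<lambda>_ _. 0)} else
           (let S = fst ` \<Union>T in
            {(cone_class K ` (V \<times> {0<..<1}),
              \<lambda>c. (\<psi> (fst (the_elem c)))(sdim L S := snd (the_elem c))) | V \<psi>.
             (V, \<psi>) \<in> atlas L S})) \<rparr>)"


section \<open>Stratified spaces\<close>

definition local_trivialization ::
    "'x decomposition \<Rightarrow> 'x set \<Rightarrow> 'x \<Rightarrow> 'x set \<Rightarrow> 'x set \<Rightarrow> 'a decomposition \<Rightarrow>
     ('x \<Rightarrow> 'x \<times> ('a \<times> real) set) \<Rightarrow> bool" where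
  "local_trivialization X S x U B L \<phi> \<longleftrightarrow>
     openin (top_of X) U \<and> x \<in> U \<and>
     open_ball_around (subtopology (top_of X) S) (sdim X S) (atlas X S) x B \<and>
     homeomorphic_map (subtopology (top_of X) U)
       (prod_topology (subtopology (top_of X) B) (open_cone (top_of L) 1)) \<phi> \<and>
     {\<phi> ` (T \<inter> U) | T. T \<in> strata X \<and> T \<inter> U \<noteq> {}} =
     {B \<times> T' | T'. T' \<in> strata (cone_decomposition L)}"

text \<open>Links are taken over the same type as \<open>X\<close>. This is no restriction: a link \<open>L\<close> of \<open>x\<close> is
  homeomorphic to the slice \<open>{x} \<times> L \<times> {1/2}\<close>, i.e. to a subspace of \<open>X\<close>. The depth of \<open>L\<close> is
  smaller than that of the stratum of \<open>x\<close>, which is finite since the strata are locally finite, so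
  the recursion on the depth is well founded and is expressed by an inductive predicate; it starts
  from the empty link.\<close>

inductive stratified_space :: "'a decomposition \<Rightarrow> bool" where
  "\<lbrakk> decomposed_space X;
     \<forall>S\<in>strata X. \<forall>x\<in>S. \<exists>U B L \<phi>.
       stratified_space L \<and> compact_space (top_of L) \<and> local_trivialization X S x U B L \<phi> \<rbrakk>
   \<Longrightarrow> stratified_space X"


section \<open>Smooth structures\<close>

definition continuous_subalgebra :: "'a topology \<Rightarrow> ('a \<Rightarrow> real) set \<Rightarrow> bool" where
  "continuous_subalgebra X C \<longleftrightarrow>
     (\<forall>f\<in>C. continuous_map X euclideanreal f) \<and>
     (\<forall>a. (\<lambda>x. a) \<in> C) \<and>
     (\<forall>f\<in>C. \<forall>g\<in>C. (\<lambda>x. f x + g x) \<in> C \<and> (\<lambda>x. f x * g x) \<in> C)"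

definition C_infinity_ring :: "('a \<Rightarrow> real) set \<Rightarrow> bool" where
  "C_infinity_ring C \<longleftrightarrow>
     (\<forall>n G f. smooth_on n (topspace (Euclidean_space n)) G \<and> (\<forall>i<n. f i \<in> C) \<longrightarrow>
        (\<lambda>x. G (\<lambda>i. if i < n then f i x else 0)) \<in> C)"

text \<open>The functions on the open set \<open>U\<close> belonging to the sheaf associated with \<open>C\<close>.\<close>

definition sections_on ::
    "'a topology \<Rightarrow> ('a \<Rightarrow> real) set \<Rightarrow> 'a set \<Rightarrow> ('a \<Rightarrow> real) set" where
  "sections_on X C U =
     {f. \<forall>x\<in>U. \<exists>W g. openin X W \<and> x \<in> W \<and> W \<subseteq> U \<and> g \<in> C \<and> (\<forall>y\<in>W. f y = g y)}"

definition germ_defined :: "'a topology \<Rightarrow> ('a \<Rightarrow> real) set \<Rightarrow> bool" where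
  "germ_defined X C \<longleftrightarrow> sections_on X C (topspace X) \<subseteq> C"

definition germ_defined_algebra :: "'a topology \<Rightarrow> ('a \<Rightarrow> real) set \<Rightarrow> bool" where
  "germ_defined_algebra X C \<longleftrightarrow>
     continuous_subalgebra X C \<and> C_infinity_ring C \<and> germ_defined X C"

definition product_smooth_structure ::
    "'a topology \<Rightarrow> ('a \<Rightarrow> real) set \<Rightarrow> 'b topology \<Rightarrow> ('b \<Rightarrow> real) set \<Rightarrow> ('a \<times> 'b \<Rightarrow> real) set" where
  "product_smooth_structure Y\<^sub>1 C\<^sub>1 Y\<^sub>2 C\<^sub>2 =
     {F. \<forall>p\<in>topspace (prod_topology Y\<^sub>1 Y\<^sub>2). \<exists>W n k G f h.
        openin (prod_topology Y\<^sub>1 Y\<^sub>2) W \<and> p \<in> W \<and>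
        smooth_on (n + k) (topspace (Euclidean_space (n + k))) G \<and>
        (\<forall>i<n. f i \<in> C\<^sub>1) \<and> (\<forall>j<k. h j \<in> C\<^sub>2) \<and>
        (\<forall>(y\<^sub>1, y\<^sub>2)\<in>W. F (y\<^sub>1, y\<^sub>2) =
           G (\<lambda>i. if i < n then f i y\<^sub>1 else if i < n + k then h (i - n) y\<^sub>2 else 0))}"

definition pullback_on :: "'a set \<Rightarrow> ('a \<Rightarrow> 'b) \<Rightarrow> ('b \<Rightarrow> real) set \<Rightarrow> ('a \<Rightarrow> real) set" where
  "pullback_on U \<phi> F = {f. \<exists>g\<in>F. \<forall>y\<in>U. f y = g (\<phi> y)}"

text \<open>\<open>C\<^sup>\<infinity>(U) = \<phi>\<^sup>*(C\<^sup>\<infinity>(B \<times> cL(1)))\<close>, where \<open>cL(1)\<close> carries the algebra \<open>CC\<close>.\<close>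

definition smoothly_trivialized ::
    "'x decomposition \<Rightarrow> ('x \<Rightarrow> real) set \<Rightarrow> 'x set \<Rightarrow> 'x set \<Rightarrow> 'x set \<Rightarrow> 'a decomposition \<Rightarrow>
     (('a \<times> real) set \<Rightarrow> real) set \<Rightarrow> ('x \<Rightarrow> 'x \<times> ('a \<times> real) set) \<Rightarrow> bool" where
  "smoothly_trivialized X C S U B L CC \<phi> \<longleftrightarrow>
     sections_on (top_of X) C U =
     pullback_on U \<phi>
       (product_smooth_structure
          (subtopology (top_of X) B) (manifold_smooth_functions (sdim X S) (atlas X S) B)
          (open_cone (top_of L) 1) CC)"

definition cone_restriction_smooth ::
    "'a topology \<Rightarrow> ('a \<Rightarrow> real) set \<Rightarrow> (('a \<times> real) set \<Rightarrow> real) set \<Rightarrow> bool" where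
  "cone_restriction_smooth L C CC \<longleftrightarrow>
     (\<forall>F\<in>CC. (\<lambda>p. F (cone_class L p)) \<in>
        product_smooth_structure L C (top_of_set {0<..<1}) {h. smooth_real_on {0<..<1} h})"

definition cone_contains_radial ::
    "'a topology \<Rightarrow> (('a \<times> real) set \<Rightarrow> real) set \<Rightarrow> bool" where
  "cone_contains_radial L CC \<longleftrightarrow>
     (\<forall>h K F. smooth_real_on {0<..<1} h \<and> compact K \<and> K \<subseteq> {0<..<1} \<and>
        (\<forall>t\<in>{0<..<1} - K. h t = 0) \<and>
        F (cone_vertex L) = 0 \<and>
        (\<forall>z\<in>topspace L. \<forall>t\<in>{0<..<1}. F (cone_class L (z, t)) = h t) \<longrightarrow> F \<in> CC)"

text \<open>\<open>smooth_structure X C\<close>: \<open>C\<close> is a smooth structure on the stratified space \<open>X\<close>.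
  \<open>smooth_cone L CL CC\<close>: \<open>CC\<close> is a smooth structure on \<open>cL(1)\<close>, the cone over the compact
  stratified space \<open>L\<close> with smooth structure \<open>CL\<close>. A cone is itself a stratified space, so \<open>CC\<close> has
  to be locally trivial too; at the vertex this condition refers back to \<open>cL(1)\<close> itself (via the
  identity), so that only the points off the vertex contribute, where the links are of smaller
  depth.\<close>

inductive
  smooth_structure :: "'a decomposition \<Rightarrow> ('a \<Rightarrow> real) set \<Rightarrow> bool" and
  smooth_cone :: "'a decomposition \<Rightarrow> ('a \<Rightarrow> real) set \<Rightarrow> (('a \<times> real) set \<Rightarrow> real) set \<Rightarrow> bool"
where
  smooth_structureI:
  "\<lbrakk> stratified_space X;
     germ_defined_algebra (top_of X) C;
     \<forall>S\<in>strata X. \<forall>x\<in>S. \<exists>U B L \<phi> CL CC.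
       local_trivialization X S x U B L \<phi> \<and> smooth_cone L CL CC \<and>
       smoothly_trivialized X C S U B L CC \<phi> \<rbrakk>
   \<Longrightarrow> smooth_structure X C"
| smooth_coneI:
  "\<lbrakk> stratified_space L; compact_space (top_of L); smooth_structure L CL;
     germ_defined_algebra (open_cone (top_of L) 1) CC;
     cone_restriction_smooth (top_of L) CL CC;
     cone_contains_radial (top_of L) CC;
     \<forall>S\<in>strata (cone_decomposition L) - {{cone_vertex (top_of L)}}. \<forall>x\<in>S. \<exists>U B L' \<phi> CL' CC'.
       local_trivialization (cone_decomposition L) S x U B L' \<phi> \<and> smooth_cone L' CL' CC' \<and>
       smoothly_trivialized (cone_decomposition L) CC S U B L' CC' \<phi> \<rbrakk>
   \<Longrightarrow> smooth_cone L CL CC"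


section \<open>Partitions of unity\<close>

definition partition_of_unity :: "'a topology \<Rightarrow> 'i set \<Rightarrow> ('i \<Rightarrow> 'a \<Rightarrow> real) \<Rightarrow> bool" where
  "partition_of_unity X I f \<longleftrightarrow>
     (\<forall>i\<in>I. continuous_map X euclideanreal (f i) \<and> (\<forall>x\<in>topspace X. 0 \<le> f i x \<and> f i x \<le> 1)) \<and>
     (\<forall>x\<in>topspace X. \<exists>V. openin X V \<and> x \<in> V \<and> finite {i \<in> I. \<exists>y\<in>V. f i y \<noteq> 0}) \<and>
     (\<forall>x\<in>topspace X. (\<Sum>i\<in>{i \<in> I. f i x \<noteq> 0}. f i x) = 1)"

definition support_in :: "'a topology \<Rightarrow> ('a \<Rightarrow> real) \<Rightarrow> 'a set" where
  "support_in X f = X closure_of {x \<in> topspace X. f x \<noteq> 0}"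

definition locally_finite_open_cover :: "'a topology \<Rightarrow> 'i set \<Rightarrow> ('i \<Rightarrow> 'a set) \<Rightarrow> bool" where
  "locally_finite_open_cover X I U \<longleftrightarrow>
     (\<forall>i\<in>I. openin X (U i)) \<and> (\<Union>i\<in>I. U i) = topspace X \<and>
     (\<forall>x\<in>topspace X. \<exists>V. openin X V \<and> x \<in> V \<and> finite {i \<in> I. U i \<inter> V \<noteq> {}})"

end

theory Submission
  imports Defs
begin

text \<open>Every point has smooth bump functions with arbitrarily small support, by induction on the
  smooth structure of the cones: near the vertex of a cone they are radial, off the vertex and on
  \<open>X\<close> itself they are products, in a local trivialization, of a bump function on a ball and one on
  a cone with link of smaller depth. The compact sets \<open>cl U\<^sub>i\<close> are covered by finitely many of these,
  each supported in some \<open>U\<^sub>j\<close>; by compactness and local finiteness only finitely many are assigned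
  to each \<open>j\<close>. Summing them gives \<open>g\<^sub>j\<close>, and \<open>f\<^sub>j = g\<^sub>j / \<Sum>\<^sub>k g\<^sub>k\<close>.\<close>

section \<open>Smooth functions\<close>

text \<open>Two features of the axioms shape the argument. First, a \<open>C_infinity_ring\<close>
  admits only outer functions that are smooth on a whole Euclidean space. Division by the sum is
  therefore not an admissible operation as it stands: near each point the reciprocal is replaced by
  a globally smooth function agreeing with it on the values that occur, and the germs are glued.
  Second, bumps are built inside local trivializations and have to be continued by zero.
  Germ-definedness allows this only if a closed set inside the chart contains all points where the
  bump is nonzero; the complement of that set and the chart then form an open cover. So regularity
  is needed on every space involved. For X it follows from local compactness, which the cover with
  compact closures provides. For a cone it is transported from the product of the link with the
  half-line, since collapsing a compact bottom is a perfect map.\<close>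

text \<open>Derivatives are quantified existentially instead of iterating \<open>deriv\<close>, so
  that the closure properties follow by induction from the product and chain rules without computing
  any \<open>deriv\<close>.\<close>

primrec k_differentiable :: "nat \<Rightarrow> (real \<Rightarrow> real) \<Rightarrow> bool" where
  "k_differentiable 0 h \<longleftrightarrow> True"
| "k_differentiable (Suc k) h \<longleftrightarrow>
     (\<exists>D. (\<forall>t. (h has_real_derivative D t) (at t)) \<and> k_differentiable k D)"

lemma k_differentiable_SucI:
  "(\<And>t. (h has_real_derivative D t) (at t)) \<Longrightarrow> k_differentiable k D \<Longrightarrow>
    k_differentiable (Suc k) h"
  by auto

lemma k_differentiable_Suc_imp: "k_differentiable (Suc k) h \<Longrightarrow> k_differentiable k h"
  by (induction k arbitrary: h) auto

lemma k_differentiable_const: "k_differentiable k (\<lambda>t. c)"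
  by (induction k arbitrary: c) (auto intro!: exI[where x = "\<lambda>_. 0"])

lemma k_differentiable_ident: "k_differentiable k (\<lambda>t. t)"
  by (cases k) (auto intro!: exI[where x = "\<lambda>_. 1"] k_differentiable_const)

lemma k_differentiable_add:
  assumes "k_differentiable k f" and "k_differentiable k g"
  shows "k_differentiable k (\<lambda>t. f t + g t)"
  using assms
proof (induction k arbitrary: f g)
  case (Suc k)
  then obtain D E where "\<forall>t. (f has_real_derivative D t) (at t)" "k_differentiable k D"
    and "\<forall>t. (g has_real_derivative E t) (at t)" "k_differentiable k E"
    by auto
  then show ?case
    using Suc.IH by (auto intro!: exI[where x = "\<lambda>t. D t + E t"] derivative_intros)
qed simp

lemma k_differentiable_mult:
  assumes "k_differentiable k f" and "k_differentiable k g"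
  shows "k_differentiable k (\<lambda>t. f t * g t)"
  using assms
proof (induction k arbitrary: f g)
  case (Suc k)
  then obtain D E where DE: "\<forall>t. (f has_real_derivative D t) (at t)" "k_differentiable k D"
    "\<forall>t. (g has_real_derivative E t) (at t)" "k_differentiable k E"
    by auto
  moreover have "k_differentiable k f" "k_differentiable k g"
    using Suc.prems k_differentiable_Suc_imp by blast+
  ultimately have "k_differentiable k (\<lambda>t. D t * g t + E t * f t)"
    using Suc.IH by (intro k_differentiable_add) auto
  moreover have "((\<lambda>t. f t * g t) has_real_derivative D t * g t + E t * f t) (at t)" for t
    using DE by (auto intro!: DERIV_mult)
  ultimately show ?case
    by (intro k_differentiable_SucI)
qed simp

text \<open>The derivative \<open>- D / f^2\<close> contains the reciprocal itself as a factor; with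
  \<open>f\<close> fixed, the induction hypothesis covers that factor.\<close>

lemma k_differentiable_inverse:
  assumes "k_differentiable k f" and "\<And>t. f t \<noteq> 0"
  shows "k_differentiable k (\<lambda>t. inverse (f t))"
  using assms(1)
proof (induction k)
  case (Suc k)
  then obtain D where D: "\<forall>t. (f has_real_derivative D t) (at t)" "k_differentiable k D"
    by auto
  have "k_differentiable k (\<lambda>t. inverse (f t))"
    using Suc k_differentiable_Suc_imp by blast
  then have "k_differentiable k (\<lambda>t. (-1) * (D t * (inverse (f t) * inverse (f t))))"
    using D by (intro k_differentiable_mult k_differentiable_const)
  moreover have "((\<lambda>t. inverse (f t)) has_real_derivative
      (-1) * (D t * (inverse (f t) * inverse (f t)))) (at t)" for t
    using DERIV_inverse_fun[OF D(1)[rule_format], of t] assms(2)[of t]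
    by (simp add: power2_eq_square)
  ultimately show ?case
    by (intro k_differentiable_SucI)
qed simp

lemma k_differentiable_compose:
  assumes "k_differentiable k f" and "k_differentiable k g"
  shows "k_differentiable k (\<lambda>t. f (g t))"
  using assms
proof (induction k arbitrary: f g)
  case (Suc k)
  then obtain D E where DE: "\<forall>t. (f has_real_derivative D t) (at t)" "k_differentiable k D"
    "\<forall>t. (g has_real_derivative E t) (at t)" "k_differentiable k E"
    by auto
  moreover have "k_differentiable k g"
    using Suc.prems k_differentiable_Suc_imp by blast
  ultimately have "k_differentiable k (\<lambda>t. D (g t) * E t)"
    using Suc.IH by (intro k_differentiable_mult) auto
  moreover have "((\<lambda>t. f (g t)) has_real_derivative D (g t) * E t) (at t)" for t
    using DE DERIV_chain2 by blast
  ultimately show ?case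
    by (intro k_differentiable_SucI)
qed simp

definition smooth_real :: "(real \<Rightarrow> real) \<Rightarrow> bool" where
  "smooth_real h \<longleftrightarrow> (\<forall>k. k_differentiable k h)"

text \<open>Each order k comes with its own derivative function; uniqueness of derivatives makes all
  of them \<open>deriv h\<close>, so one function serves every order.\<close>

lemma smooth_real_derivative:
  assumes "smooth_real h"
  obtains D where "\<And>t. (h has_real_derivative D t) (at t)" and "smooth_real D"
proof
  have D: "\<exists>D. (\<forall>t. (h has_real_derivative D t) (at t)) \<and> k_differentiable k D" for k
    using assms k_differentiable.simps(2) unfolding smooth_real_def by blast
  then show h: "(h has_real_derivative deriv h t) (at t)" for t
    by (metis DERIV_imp_deriv)
  show "smooth_real (deriv h)"
    unfolding smooth_real_def
  proof
    fix k
    obtain D where "\<forall>t. (h has_real_derivative D t) (at t)" "k_differentiable k D"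
      using D by blast
    moreover from this have "D = deriv h"
      by (metis DERIV_imp_deriv ext)
    ultimately show "k_differentiable k (deriv h)"
      by simp
  qed
qed

lemma smooth_real_const: "smooth_real (\<lambda>t. c)"
  and smooth_real_ident: "smooth_real (\<lambda>t. t)"
  and smooth_real_add: "smooth_real f \<Longrightarrow> smooth_real g \<Longrightarrow> smooth_real (\<lambda>t. f t + g t)"
  and smooth_real_mult: "smooth_real f \<Longrightarrow> smooth_real g \<Longrightarrow> smooth_real (\<lambda>t. f t * g t)"
  and smooth_real_inverse: "smooth_real f \<Longrightarrow> (\<And>t. f t \<noteq> 0) \<Longrightarrow> smooth_real (\<lambda>t. inverse (f t))"
  and smooth_real_compose: "smooth_real f \<Longrightarrow> smooth_real g \<Longrightarrow> smooth_real (\<lambda>t. f (g t))"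
  unfolding smooth_real_def
  by (auto intro: k_differentiable_const k_differentiable_ident k_differentiable_add
      k_differentiable_mult k_differentiable_inverse k_differentiable_compose)

lemma smooth_real_diff: "smooth_real f \<Longrightarrow> smooth_real g \<Longrightarrow> smooth_real (\<lambda>t. f t - g t)"
  using smooth_real_add[OF _ smooth_real_mult[OF smooth_real_const[of "-1"]], of f g] by simp

lemmas smooth_real_intros = smooth_real_const smooth_real_ident smooth_real_add smooth_real_mult
  smooth_real_diff

text \<open>Passes from the existential form to iterated \<open>deriv\<close>, the form in which
  \<open>cone_contains_radial\<close> asks for smoothness.\<close>

lemma smooth_real_imp_smooth_real_on:
  assumes "smooth_real h"
  shows "smooth_real_on T h"
proof -
  have "smooth_real ((deriv ^^ k) h)" for k
  proof (induction k)
    case (Suc k)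
    then obtain D where "\<And>t. ((deriv ^^ k) h has_real_derivative D t) (at t)" and "smooth_real D"
      using smooth_real_derivative by blast
    moreover from this(1) have "deriv ((deriv ^^ k) h) = D"
      using DERIV_imp_deriv by blast
    ultimately show ?case
      by simp
  qed (simp add: assms)
  then show ?thesis
    unfolding smooth_real_on_def field_differentiable_def by (meson smooth_real_derivative)
qed

text \<open>The family \<open>t \<mapsto> t\<^sup>-\<^sup>n exp (-1/t)\<close> contains the flat exponential and spans a space closed under
  differentiation.\<close>

definition flat_exp_aux :: "nat \<Rightarrow> real \<Rightarrow> real" where
  "flat_exp_aux n t = (if 0 < t then inverse t ^ n * exp (- inverse t) else 0)"

text \<open>The substitution x = 1/t reduces the right-hand limit to the decay of
  \<open>x ^ n / exp x\<close>. This is what makes the family differentiable at 0.\<close>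

lemma flat_exp_aux_tendsto_0: "(flat_exp_aux n \<longlongrightarrow> 0) (at 0)"
proof -
  have "((\<lambda>x. x ^ n / exp x) \<longlongrightarrow> 0) (at_top :: real filter)"
    by (rule tendsto_power_div_exp_0)
  then have "((\<lambda>t::real. inverse t ^ n / exp (inverse t)) \<longlongrightarrow> 0) (at_right 0)"
    by (rule filterlim_compose) (rule filterlim_inverse_at_top_right)
  then have "(flat_exp_aux n \<longlongrightarrow> 0) (at_right 0)"
    by (rule Lim_transform_eventually)
      (auto simp: flat_exp_aux_def exp_minus divide_inverse eventually_at_right_less
        intro: eventually_mono[OF eventually_at_right_less])
  moreover have "(flat_exp_aux n \<longlongrightarrow> 0) (at_left 0)"
    by (rule tendsto_eventually)
      (auto simp: flat_exp_aux_def eventually_at_filter)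
  ultimately show ?thesis
    by (simp add: filterlim_at_split)
qed

lemma DERIV_flat_exp_aux:
  "(flat_exp_aux n has_real_derivative
     (- real n) * flat_exp_aux (Suc n) t + flat_exp_aux (Suc (Suc n)) t) (at t)"
proof -
  consider "t < 0" | "t = 0" | "0 < t"
    by linarith
  then show ?thesis
  proof cases
    case 1
    have "((\<lambda>_. 0) has_real_derivative 0) (at t)"
      by simp
    then have "(flat_exp_aux n has_real_derivative 0) (at t)"
      by (rule has_field_derivative_transform_within_open[of _ _ _ "{..<0}"])
        (use 1 in \<open>auto simp: flat_exp_aux_def\<close>)
    with 1 show ?thesis
      by (simp add: flat_exp_aux_def)
  next
    case 2
    \<comment> \<open>The difference quotient at 0 is the next member of the family, whose limit is
      known.\<close>
    have "(\<lambda>h. flat_exp_aux n h / h) = flat_exp_aux (Suc n)"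
      by (auto simp: flat_exp_aux_def divide_inverse)
    then have "(flat_exp_aux n has_real_derivative 0) (at 0)"
      using flat_exp_aux_tendsto_0[of "Suc n"] by (simp add: DERIV_def) (simp add: flat_exp_aux_def)
    with 2 show ?thesis
      by (simp add: flat_exp_aux_def)
  next
    case 3
    have "((\<lambda>t. inverse t ^ n * exp (- inverse t)) has_real_derivative
        (- real n) * (inverse t ^ Suc n * exp (- inverse t))
        + inverse t ^ Suc (Suc n) * exp (- inverse t)) (at t)"
    proof (cases n)
      case 0
      with 3 show ?thesis
        by (auto intro!: derivative_eq_intros)
    next
      case (Suc m)
      have inv: "(inverse has_real_derivative - (inverse t * inverse t)) (at t)"
        using DERIV_inverse[of t] 3 by (simp add: power2_eq_square)
      have "((\<lambda>t. inverse t ^ Suc m * exp (- inverse t)) has_real_derivative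
          (1 + real m) * (- (inverse t * inverse t) * inverse t ^ m) * exp (- inverse t)
          + exp (- inverse t) * - (- (inverse t * inverse t)) * inverse t ^ Suc m) (at t)"
        using DERIV_mult[OF DERIV_power_Suc[OF inv, of m] DERIV_fun_exp[OF DERIV_minus[OF inv]]]
        by simp
      then show ?thesis
        by (simp add: Suc algebra_simps)
    qed
    then have "(flat_exp_aux n has_real_derivative
        (- real n) * (inverse t ^ Suc n * exp (- inverse t))
        + inverse t ^ Suc (Suc n) * exp (- inverse t)) (at t)"
      by (rule has_field_derivative_transform_within_open[of _ _ _ "{0<..}"])
        (use 3 in \<open>auto simp: flat_exp_aux_def\<close>)
    with 3 show ?thesis
      by (simp add: flat_exp_aux_def)
  qed
qed

lemma smooth_real_flat_exp_aux: "smooth_real (flat_exp_aux n)"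
proof -
  have "k_differentiable k (flat_exp_aux n)" for k
  proof (induction k arbitrary: n)
    case (Suc k)
    have "k_differentiable k
        (\<lambda>t. (- real n) * flat_exp_aux (Suc n) t + flat_exp_aux (Suc (Suc n)) t)"
      by (intro k_differentiable_add k_differentiable_mult k_differentiable_const Suc)
    then show ?case
      by (intro k_differentiable_SucI[OF DERIV_flat_exp_aux])
  qed simp
  then show ?thesis
    by (simp add: smooth_real_def)
qed

definition flat_exp :: "real \<Rightarrow> real" where
  "flat_exp = flat_exp_aux 0"

lemma flat_exp_pos_iff: "0 < flat_exp t \<longleftrightarrow> 0 < t"
  and flat_exp_nonneg: "0 \<le> flat_exp t"
  and flat_exp_eq_0: "t \<le> 0 \<Longrightarrow> flat_exp t = 0"
  by (auto simp: flat_exp_def flat_exp_aux_def)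

lemma flat_exp_mono: "s \<le> t \<Longrightarrow> flat_exp s \<le> flat_exp t"
  by (auto simp: flat_exp_def flat_exp_aux_def)

lemma smooth_real_flat_exp: "smooth_real f \<Longrightarrow> smooth_real (\<lambda>t. flat_exp (f t))"
  unfolding flat_exp_def by (rule smooth_real_compose[OF smooth_real_flat_exp_aux])

text \<open>A \<open>C\<^sup>\<infinity>\<close>-ring only admits compositions with functions that are smooth on all of \<open>\<real>\<close>, so the
  reciprocal is extended from \<open>[c, \<infinity>)\<close>. The added term vanishes for \<open>t \<ge> c\<close> and exceeds \<open>\<bar>t\<bar>\<close> for
  \<open>t \<le> 0\<close>, which keeps the denominator positive.\<close>

lemma smooth_real_eq_inverse:
  assumes "0 < c"
  obtains \<rho> where "smooth_real \<rho>" and "\<And>t. c \<le> t \<Longrightarrow> \<rho> t = inverse t"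
proof
  let ?d = "\<lambda>t. t + inverse (flat_exp c) * ((1 + t * t) * flat_exp (c - t))"
  have "?d t > 0" for t
  proof (cases "t > 0")
    case True
    then show ?thesis
      using assms by (intro add_pos_nonneg mult_nonneg_nonneg) (auto simp: flat_exp_nonneg)
  next
    case False
    have "\<bar>t\<bar> < 1 + t * t"
    proof -
      have "0 \<le> (\<bar>t\<bar> - 1)\<^sup>2" by simp
      then show ?thesis by (simp add: power2_eq_square algebra_simps) (smt (verit) zero_le_square)
    qed
    \<comment> \<open>Monotonicity gives \<open>flat_exp (c - t) \<ge> flat_exp c\<close> for t
      \<le> 0; the factor \<open>inverse (flat_exp c)\<close> turns this into a lower bound of
      1.\<close>
    also have "\<dots> \<le> (1 + t * t) * (inverse (flat_exp c) * flat_exp (c - t))"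
    proof -
      have "0 < flat_exp c" using assms by (simp add: flat_exp_pos_iff)
      moreover have "flat_exp c \<le> flat_exp (c - t)" using False by (intro flat_exp_mono) auto
      ultimately have "1 \<le> inverse (flat_exp c) * flat_exp (c - t)"
        by (simp add: field_simps)
      then show ?thesis
        using mult_left_mono[of 1 _ "1 + t * t"] by simp
    qed
    finally show ?thesis
      by (simp add: mult_ac)
  qed
  then show "smooth_real (\<lambda>t. inverse (?d t))"
    by (intro smooth_real_inverse smooth_real_flat_exp smooth_real_intros)
      (simp add: less_imp_neq[symmetric])
  show "inverse (?d t) = inverse t" if "c \<le> t" for t
    using that by (simp add: flat_exp_eq_0)
qed

section \<open>Smooth functions of several variables\<close>

lemma C_k_on_imp_continuous:
  "C_k_on k n U G \<Longrightarrow> continuous_map (subtopology (Euclidean_space n) U) euclideanreal G"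
  by (cases k) auto

lemma C_k_on_SucD:
  assumes "C_k_on (Suc k) n U G" and "i < n"
  shows "\<exists>D. (\<forall>x\<in>U. ((\<lambda>t. G (x(i := t))) has_real_derivative D x) (at (x i))) \<and> C_k_on k n U D"
  using assms by simp

lemma C_k_on_SucI:
  assumes "continuous_map (subtopology (Euclidean_space n) U) euclideanreal G"
    and "\<And>i. i < n \<Longrightarrow> \<exists>D. (\<forall>x\<in>U. ((\<lambda>t. G (x(i := t))) has_real_derivative D x) (at (x i))) \<and>
      C_k_on k n U D"
  shows "C_k_on (Suc k) n U G"
  using assms by simp

lemma C_k_on_Suc_imp: "C_k_on (Suc k) n U G \<Longrightarrow> C_k_on k n U G"
proof (induction k arbitrary: G)
  case (Suc k)
  show ?case
  proof (rule C_k_on_SucI)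
    fix i assume "i < n"
    from C_k_on_SucD[OF Suc.prems this] Suc.IH
    show "\<exists>D. (\<forall>x\<in>U. ((\<lambda>t. G (x(i := t))) has_real_derivative D x) (at (x i))) \<and> C_k_on k n U D"
      by blast
  qed (rule C_k_on_imp_continuous[OF Suc.prems])
qed simp

lemma C_k_on_const: "C_k_on k n U (\<lambda>v. c)"
proof (induction k arbitrary: c)
  case (Suc k)
  show ?case
    by (intro C_k_on_SucI exI[where x = "\<lambda>_. 0"]) (simp_all add: Suc)
qed simp

lemma C_k_on_coordinate: "C_k_on k n U (\<lambda>v. v i)"
proof -
  have cont: "continuous_map (subtopology (Euclidean_space n) U) euclideanreal (\<lambda>v. v i)"
    unfolding Euclidean_space_def
    by (intro continuous_map_from_subtopology continuous_map_product_projection) simp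
  show ?thesis
  proof (cases k)
    case (Suc k')
    show ?thesis
      unfolding Suc
    proof (rule C_k_on_SucI[OF cont])
      fix j
      have "((\<lambda>t. (x(j := t)) i) has_real_derivative (if i = j then 1 else 0)) (at (x j))"
        for x :: "nat \<Rightarrow> real"
        by auto
      then show "\<exists>D. (\<forall>x\<in>U. ((\<lambda>t. (x(j := t)) i) has_real_derivative D x) (at (x j))) \<and>
          C_k_on k' n U D"
        using C_k_on_const[of k' n U "if i = j then 1 else 0"]
        by (intro exI[where x = "\<lambda>_. if i = j then 1 else 0"]) blast
    qed
  qed (simp add: cont)
qed

lemma C_k_on_add:
  assumes "C_k_on k n U F" and "C_k_on k n U G"
  shows "C_k_on k n U (\<lambda>v. F v + G v)"
  using assms
proof (induction k arbitrary: F G)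
  case 0
  then show ?case by (simp add: continuous_map_add)
next
  case (Suc k)
  show ?case
  proof (rule C_k_on_SucI)
    show "continuous_map (subtopology (Euclidean_space n) U) euclideanreal (\<lambda>v. F v + G v)"
      using Suc.prems[THEN C_k_on_imp_continuous] by (rule continuous_map_add)
  next
    fix i assume i: "i < n"
    obtain D where "\<forall>x\<in>U. ((\<lambda>t. F (x(i := t))) has_real_derivative D x) (at (x i))"
      and "C_k_on k n U D"
      using C_k_on_SucD[OF Suc.prems(1) i] by blast
    moreover obtain E where "\<forall>x\<in>U. ((\<lambda>t. G (x(i := t))) has_real_derivative E x) (at (x i))"
      and "C_k_on k n U E"
      using C_k_on_SucD[OF Suc.prems(2) i] by blast
    ultimately show "\<exists>D. (\<forall>x\<in>U. ((\<lambda>t. F (x(i := t)) + G (x(i := t))) has_real_derivative D x)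
        (at (x i))) \<and> C_k_on k n U D"
      by (intro exI[where x = "\<lambda>x. D x + E x"] conjI ballI DERIV_add Suc.IH) simp_all
  qed
qed

lemma C_k_on_mult:
  assumes "C_k_on k n U F" and "C_k_on k n U G"
  shows "C_k_on k n U (\<lambda>v. F v * G v)"
  using assms
proof (induction k arbitrary: F G)
  case 0
  then show ?case by (simp add: continuous_map_real_mult)
next
  case (Suc k)
  show ?case
  proof (rule C_k_on_SucI)
    show "continuous_map (subtopology (Euclidean_space n) U) euclideanreal (\<lambda>v. F v * G v)"
      using Suc.prems[THEN C_k_on_imp_continuous] by (rule continuous_map_real_mult)
  next
    fix i assume i: "i < n"
    obtain D where D: "\<forall>x\<in>U. ((\<lambda>t. F (x(i := t))) has_real_derivative D x) (at (x i))"
      "C_k_on k n U D"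
      using C_k_on_SucD[OF Suc.prems(1) i] by blast
    obtain E where E: "\<forall>x\<in>U. ((\<lambda>t. G (x(i := t))) has_real_derivative E x) (at (x i))"
      "C_k_on k n U E"
      using C_k_on_SucD[OF Suc.prems(2) i] by blast
    have "((\<lambda>t. F (x(i := t)) * G (x(i := t))) has_real_derivative D x * G x + E x * F x) (at (x i))"
      if "x \<in> U" for x
      using DERIV_mult[OF D(1)[rule_format, OF that] E(1)[rule_format, OF that]] by simp
    moreover have "C_k_on k n U (\<lambda>x. D x * G x + E x * F x)"
      using Suc.prems[THEN C_k_on_Suc_imp] D(2) E(2) by (intro C_k_on_add Suc.IH)
    ultimately show "\<exists>D. (\<forall>x\<in>U. ((\<lambda>t. F (x(i := t)) * G (x(i := t))) has_real_derivative D x)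
        (at (x i))) \<and> C_k_on k n U D"
      by (intro exI[where x = "\<lambda>x. D x * G x + E x * F x"] conjI ballI)
  qed
qed

text \<open>A partial derivative is \<open>h' (G v)\<close> times one of \<open>G\<close>. The
  induction varies the outer function and keeps \<open>G\<close>, because \<open>h'\<close> is again
  smooth on the whole line.\<close>

lemma C_k_on_compose:
  assumes "smooth_real h" and "C_k_on k n U G"
  shows "C_k_on k n U (\<lambda>v. h (G v))"
  using assms
proof (induction k arbitrary: h)
  have cont: "continuous_map (subtopology (Euclidean_space n) U) euclideanreal (\<lambda>v. h (G v))"
    if "smooth_real h" "C_k_on k n U G" for h :: "real \<Rightarrow> real" and k
  proof -
    have "continuous_map euclideanreal euclideanreal h"
      using that(1) by (metis DERIV_isCont continuous_at_imp_continuous_on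
          continuous_map_iff_continuous2 smooth_real_derivative)
    from continuous_map_compose[OF C_k_on_imp_continuous[OF that(2)] this] show ?thesis
      by (simp add: o_def)
  qed
  {
    case 0
    then show ?case using cont[OF 0] by simp
  next
    case (Suc k)
    obtain h' where h': "\<And>t. (h has_real_derivative h' t) (at t)" and "smooth_real h'"
      using smooth_real_derivative[OF Suc.prems(1)] by blast
    then have smooth': "C_k_on k n U (\<lambda>v. h' (G v))"
      using Suc.IH Suc.prems(2)[THEN C_k_on_Suc_imp] by simp
    show ?case
    proof (rule C_k_on_SucI)
      show "continuous_map (subtopology (Euclidean_space n) U) euclideanreal (\<lambda>v. h (G v))"
        using Suc.prems by (rule cont)
    next
      fix i assume i: "i < n"
      obtain D where D: "\<forall>x\<in>U. ((\<lambda>t. G (x(i := t))) has_real_derivative D x) (at (x i))"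
        "C_k_on k n U D"
        using C_k_on_SucD[OF Suc.prems(2) i] by blast
      have "((\<lambda>t. h (G (x(i := t)))) has_real_derivative h' (G x) * D x) (at (x i))"
        if "x \<in> U" for x
        using DERIV_chain2[OF _ D(1)[rule_format, OF that], of h "h' (G x)"] h' by simp
      then show "\<exists>D. (\<forall>x\<in>U. ((\<lambda>t. h (G (x(i := t)))) has_real_derivative D x) (at (x i))) \<and>
          C_k_on k n U D"
        using C_k_on_mult[OF smooth' D(2)] by (intro exI[where x = "\<lambda>x. h' (G x) * D x"]) simp
    qed
  }
qed

lemma smooth_on_const: "smooth_on n U (\<lambda>v. c)"
  and smooth_on_coordinate: "smooth_on n U (\<lambda>v. v i)"
  and smooth_on_add: "smooth_on n U F \<Longrightarrow> smooth_on n U G \<Longrightarrow> smooth_on n U (\<lambda>v. F v + G v)"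
  and smooth_on_mult: "smooth_on n U F \<Longrightarrow> smooth_on n U G \<Longrightarrow> smooth_on n U (\<lambda>v. F v * G v)"
  and smooth_on_compose: "smooth_real h \<Longrightarrow> smooth_on n U G \<Longrightarrow> smooth_on n U (\<lambda>v. h (G v))"
  unfolding smooth_on_def
  by (auto intro: C_k_on_const C_k_on_coordinate C_k_on_add C_k_on_mult C_k_on_compose)

lemma smooth_on_sum:
  "(\<And>a. a \<in> A \<Longrightarrow> smooth_on n U (F a)) \<Longrightarrow> smooth_on n U (\<lambda>v. \<Sum>a\<in>A. F a v)"
  by (induction A rule: infinite_finite_induct) (auto intro: smooth_on_const smooth_on_add)

section \<open>Bump functions\<close>

context
  fixes X :: "'a topology" and C :: "('a \<Rightarrow> real) set"
  assumes C: "germ_defined_algebra X C"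
begin

lemma germ_defined_algebra_continuous: "f \<in> C \<Longrightarrow> continuous_map X euclideanreal f"
  and germ_defined_algebra_const: "(\<lambda>x. a) \<in> C"
  and germ_defined_algebra_add: "f \<in> C \<Longrightarrow> g \<in> C \<Longrightarrow> (\<lambda>x. f x + g x) \<in> C"
  and germ_defined_algebra_mult: "f \<in> C \<Longrightarrow> g \<in> C \<Longrightarrow> (\<lambda>x. f x * g x) \<in> C"
  using C by (auto simp: germ_defined_algebra_def continuous_subalgebra_def)

lemma germ_defined_algebra_sum:
  "(\<And>a. a \<in> A \<Longrightarrow> f a \<in> C) \<Longrightarrow> (\<lambda>x. \<Sum>a\<in>A. f a x) \<in> C"
proof (induction A rule: infinite_finite_induct)
  case (insert a A)
  then show ?case
    using germ_defined_algebra_add[of "f a" "\<lambda>x. \<Sum>a\<in>A. f a x"] by simp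
qed (simp_all add: germ_defined_algebra_const)

lemma germ_defined_algebra_compose:
  assumes "smooth_real h" and "f \<in> C"
  shows "(\<lambda>x. h (f x)) \<in> C"
proof -
  have "smooth_on 1 (topspace (Euclidean_space 1)) (\<lambda>v. h (v 0))"
    using assms(1) smooth_on_coordinate by (rule smooth_on_compose)
  moreover have "C_infinity_ring C"
    using C by (simp add: germ_defined_algebra_def)
  ultimately have "(\<lambda>x. (\<lambda>v. h (v 0)) (\<lambda>i::nat. if i < 1 then f x else 0)) \<in> C"
    using assms(2)
      C_infinity_ring_def[THEN iffD1, rule_format, where n = 1 and G = "\<lambda>v. h (v 0)" and f = "\<lambda>_. f"]
    by blast
  then show ?thesis
    by simp
qed

text \<open>The form in which germ-definedness is applied: to reciprocals, to locally finite sums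
  and to continuation by zero.\<close>

lemma germ_defined_algebra_local:
  assumes "\<And>x. x \<in> topspace X \<Longrightarrow> \<exists>W g. openin X W \<and> x \<in> W \<and> g \<in> C \<and> (\<forall>y\<in>W. f y = g y)"
  shows "f \<in> C"
proof -
  have "f \<in> sections_on X C (topspace X)"
    unfolding sections_on_def mem_Collect_eq
  proof
    fix x assume "x \<in> topspace X"
    then obtain W g where "openin X W" "x \<in> W" "g \<in> C" "\<forall>y\<in>W. f y = g y"
      using assms by blast
    then show "\<exists>W g. openin X W \<and> x \<in> W \<and> W \<subseteq> topspace X \<and> g \<in> C \<and> (\<forall>y\<in>W. f y = g y)"
      using openin_subset by (intro exI[of _ W] exI[of _ g]) simp
  qed
  moreover have "sections_on X C (topspace X) \<subseteq> C"
    using C by (simp add: germ_defined_algebra_def germ_defined_def)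
  ultimately show ?thesis
    by (rule subsetD[rotated])
qed

text \<open>A positive \<open>f\<close> need not be bounded away from 0, so no single smooth
  substitute for the reciprocal works everywhere. Near x the values exceed \<open>f x / 2\<close>,
  and a substitute for that level is composed with \<open>f\<close>.\<close>

lemma germ_defined_algebra_inverse:
  assumes "f \<in> C" and "\<And>x. x \<in> topspace X \<Longrightarrow> 0 < f x"
  shows "(\<lambda>x. inverse (f x)) \<in> C"
proof (rule germ_defined_algebra_local)
  fix x assume "x \<in> topspace X"
  then have c: "0 < f x / 2"
    using assms(2) by simp
  obtain \<rho> where \<rho>: "smooth_real \<rho>" "\<And>t. f x / 2 \<le> t \<Longrightarrow> \<rho> t = inverse t"
    using smooth_real_eq_inverse[OF c] by blast
  let ?W = "{y \<in> topspace X. f y \<in> {f x / 2<..}}"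
  have "openin X ?W"
    using openin_continuous_map_preimage[OF germ_defined_algebra_continuous[OF assms(1)], of "{f x / 2<..}"]
    by (simp flip: open_openin)
  moreover have "(\<lambda>y. \<rho> (f y)) \<in> C"
    using \<rho>(1) assms(1) by (rule germ_defined_algebra_compose)
  ultimately show "\<exists>W g. openin X W \<and> x \<in> W \<and> g \<in> C \<and> (\<forall>y\<in>W. inverse (f y) = g y)"
    using \<open>x \<in> topspace X\<close> c \<rho>(2)
    by (intro exI[of _ ?W] exI[of _ "\<lambda>y. \<rho> (f y)"]) auto
qed

end

section \<open>Bump functions on balls and in local trivializations\<close>

text \<open>Vanishing off \<open>W\<close> replaces a condition on the closed support; on a regular
  space the latter is recovered by first shrinking \<open>W\<close>. The sign is prescribed only on
  the space because values outside it are unconstrained.\<close>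

definition has_bump_functions :: "'a topology \<Rightarrow> ('a \<Rightarrow> real) set \<Rightarrow> bool" where
  "has_bump_functions X C \<longleftrightarrow>
     (\<forall>W x. openin X W \<and> x \<in> W \<longrightarrow>
        (\<exists>f\<in>C. (\<forall>y\<in>topspace X. 0 \<le> f y) \<and> 0 < f x \<and> (\<forall>y\<in>topspace X - W. f y = 0)))"

text \<open>Open sets come from a product topology, while bumps are built from a sum of squares: a
  basic box in the first n coordinates contains a Euclidean ball.\<close>

lemma Euclidean_space_nhd:
  assumes "openin (Euclidean_space n) W" and "c \<in> W"
  obtains \<delta> where "0 < \<delta>"
    and "\<And>v. v \<in> topspace (Euclidean_space n) \<Longrightarrow> (\<Sum>i<n. (v i - c i)\<^sup>2) < \<delta>\<^sup>2 \<Longrightarrow> v \<in> W"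
proof -
  obtain W' where W': "openin (powertop_real UNIV) W'" "W = W' \<inter> {x. \<forall>i\<ge>n. x i = 0}"
    using assms(1) by (auto simp: Euclidean_space_def openin_subtopology)
  then have "c \<in> W'"
    using assms(2) by simp
  then have "\<exists>N. finite {i \<in> UNIV. N i \<noteq> topspace euclideanreal} \<and>
      (\<forall>i\<in>UNIV. openin euclideanreal (N i)) \<and> c \<in> Pi\<^sub>E UNIV N \<and> Pi\<^sub>E UNIV N \<subseteq> W'"
    using W'(1) unfolding openin_product_topology_alt by (rule bspec[rotated])
  then obtain N where N: "\<And>i. open (N i)" "c \<in> Pi\<^sub>E UNIV N" "Pi\<^sub>E UNIV N \<subseteq> W'"
    by (auto simp flip: open_openin)
  have "\<exists>e>0. \<forall>y. \<bar>y - c i\<bar> < e \<longrightarrow> y \<in> N i" for i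
  proof -
    have "c i \<in> N i"
      using N(2) by (simp add: PiE_iff)
    then show ?thesis
      using N(1)[of i] unfolding open_dist dist_real_def by (rule bspec[rotated])
  qed
  then obtain e where e: "\<And>i. 0 < e i" "\<And>i y. \<bar>y - c i\<bar> < e i \<Longrightarrow> y \<in> N i"
    by metis
  \<comment> \<open>The inserted 1 keeps the set nonempty for n = 0.\<close>
  define \<delta> where "\<delta> = Min (insert 1 (e ` {..<n}))"
  have "0 < \<delta>"
    using e(1) by (auto simp: \<delta>_def)
  moreover have "v \<in> W" if v: "v \<in> topspace (Euclidean_space n)"
    and less: "(\<Sum>i<n. (v i - c i)\<^sup>2) < \<delta>\<^sup>2" for v
  proof -
    have "v i \<in> N i" for i
    proof (cases "i < n")
      case True
      have "(v i - c i)\<^sup>2 \<le> (\<Sum>i<n. (v i - c i)\<^sup>2)"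
        using True by (intro member_le_sum) auto
      with less have "(v i - c i)\<^sup>2 < \<delta>\<^sup>2"
        by simp
      then have "\<bar>v i - c i\<bar> < \<delta>"
        using \<open>0 < \<delta>\<close> power2_less_imp_less[of "\<bar>v i - c i\<bar>" \<delta>] by simp
      also have "\<delta> \<le> e i"
        using True by (auto simp: \<delta>_def)
      finally show ?thesis
        by (rule e(2))
    next
      case False
      \<comment> \<open>Beyond the first n coordinates both vectors vanish, so the box restricts
        nothing there.\<close>
      then have "v i = c i"
        using v assms(2) W'(2) by (auto simp: topspace_Euclidean_space)
      then show ?thesis
        using N(2) by (auto simp: PiE_iff)
    qed
    then show ?thesis
      using N(3) v W'(2) by (auto simp: PiE_iff topspace_Euclidean_space)
  qed
  ultimately show thesis
    by (rule that)
qed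

text \<open>The bump is \<open>flat_exp\<close> of \<delta> squared minus the squared distance in
  the chart. Read in a chart of the atlas, it is a smooth function of the coordinates of a
  transition map, and compatibility makes those smooth. Injectivity of \<psi> keeps points outside
  \<open>D\<close> away from the \<delta>-ball.\<close>

lemma compatible_chart_bump:
  assumes chart: "compatible_chart M n A (B, \<psi>)"
    and D: "openin (subtopology M B) D" and b: "b \<in> D"
  obtains \<beta> where "\<beta> \<in> manifold_smooth_functions n A B" and "\<And>y. 0 \<le> \<beta> y" and "0 < \<beta> b"
    and "\<And>y. y \<in> B \<Longrightarrow> y \<notin> D \<Longrightarrow> \<beta> y = 0"
proof -
  have opB: "openin (Euclidean_space n) (\<psi> ` B)" and "openin M B"
    and homeo: "homeomorphic_map (subtopology M B) (subtopology (Euclidean_space n) (\<psi> ` B)) \<psi>"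
    and smooth: "\<forall>(V, \<eta>)\<in>A. \<forall>i<n. smooth_on n (\<eta> ` (V \<inter> B)) (\<lambda>v. \<psi> (inv_into V \<eta> v) i)"
    using chart by (auto simp: compatible_chart_def is_chart_def smooth_transition_def)
  have topB: "topspace (subtopology M B) = B"
    using \<open>openin M B\<close> openin_subset by (auto)
  have DB: "D \<subseteq> B"
    using openin_subset[OF D] topB by simp
  have inj: "inj_on \<psi> B"
    using homeomorphic_imp_injective_map[OF homeo] topB by simp
  have "openin (subtopology (Euclidean_space n) (\<psi> ` B)) (\<psi> ` D)"
    using homeomorphic_map_openness[OF homeo, of D] DB topB D by auto
  then have "openin (Euclidean_space n) (\<psi> ` D)"
    using opB openin_trans_full by blast
  then obtain \<delta> where \<delta>: "0 < \<delta>" and nhd: "\<And>v. v \<in> topspace (Euclidean_space n) \<Longrightarrow>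
      (\<Sum>i<n. (v i - \<psi> b i)\<^sup>2) < \<delta>\<^sup>2 \<Longrightarrow> v \<in> \<psi> ` D"
    using Euclidean_space_nhd[of n "\<psi> ` D" "\<psi> b"] b by blast
  define \<beta> where "\<beta> y = flat_exp (\<delta>\<^sup>2 - (\<Sum>i<n. (\<psi> y i - \<psi> b i)\<^sup>2))" for y
  show thesis
  proof
    have "smooth_on n (\<eta> ` (V \<inter> B)) (\<lambda>v. \<beta> (inv_into V \<eta> v))" if "(V, \<eta>) \<in> A" for V \<eta>
    proof -
      have h: "smooth_real (\<lambda>t. flat_exp (\<delta>\<^sup>2 - t))" and q: "smooth_real (\<lambda>t. (t - a)\<^sup>2)" for a :: real
        unfolding power2_eq_square by (intro smooth_real_flat_exp smooth_real_intros)+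
      have "smooth_on n (\<eta> ` (V \<inter> B)) (\<lambda>v. (\<psi> (inv_into V \<eta> v) i - \<psi> b i)\<^sup>2)" if "i < n" for i
        by (rule smooth_on_compose[OF q]) (use smooth \<open>(V, \<eta>) \<in> A\<close> that in auto)
      then show ?thesis
        unfolding \<beta>_def by (intro smooth_on_compose[OF h smooth_on_sum]) simp
    qed
    then show "\<beta> \<in> manifold_smooth_functions n A B"
      by (auto simp: manifold_smooth_functions_def)
    show "0 \<le> \<beta> y" for y
      by (simp add: \<beta>_def flat_exp_nonneg)
    show "0 < \<beta> b"
      using \<delta> by (simp add: \<beta>_def flat_exp_pos_iff)
    show "\<beta> y = 0" if "y \<in> B" "y \<notin> D" for y
    proof -
      have "\<psi> y \<notin> \<psi> ` D"
        using that inj DB by (auto simp: inj_on_def)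
      moreover have "\<psi> y \<in> topspace (Euclidean_space n)"
        using opB openin_subset that(1) by blast
      ultimately have "\<not> (\<Sum>i<n. (\<psi> y i - \<psi> b i)\<^sup>2) < \<delta>\<^sup>2"
        using nhd by blast
      then show ?thesis
        by (simp add: \<beta>_def flat_exp_eq_0)
    qed
  qed
qed

lemma product_smooth_structure_mult:
  assumes "f \<in> C\<^sub>1" and "h \<in> C\<^sub>2"
  shows "(\<lambda>(y\<^sub>1, y\<^sub>2). f y\<^sub>1 * h y\<^sub>2) \<in> product_smooth_structure Y\<^sub>1 C\<^sub>1 Y\<^sub>2 C\<^sub>2"
proof -
  have "smooth_on (1 + 1) (topspace (Euclidean_space (1 + 1))) (\<lambda>v. v 0 * v 1)"
    by (intro smooth_on_mult smooth_on_coordinate)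
  moreover have "openin (prod_topology Y\<^sub>1 Y\<^sub>2) (topspace (prod_topology Y\<^sub>1 Y\<^sub>2))"
    by (rule openin_topspace)
  ultimately show ?thesis
    unfolding product_smooth_structure_def using assms
    by (intro CollectI ballI exI[of _ "topspace (prod_topology Y\<^sub>1 Y\<^sub>2)"] exI[of _ 1]
        exI[of _ "\<lambda>v. v 0 * v 1"] exI[of _ "\<lambda>_. f"] exI[of _ "\<lambda>_. h"]) auto
qed

lemma regular_space_nhd:
  assumes "regular_space X" and "openin X W" and "x \<in> W"
  obtains V K where "openin X V" "closedin X K" "x \<in> V" "V \<subseteq> K" "K \<subseteq> W"
  using assms unfolding neighbourhood_base_of_closedin[symmetric] neighbourhood_base_of by meson

text \<open>A local trivialization at \<open>x\<close> is not required to send \<open>x\<close> to the center of the ball and the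
  vertex of the cone, so bump functions are needed at every point of both factors.\<close>

lemma local_trivialization_bump:
  assumes C: "germ_defined_algebra (top_of X) C" and reg: "regular_space (top_of X)"
    and triv: "local_trivialization X S x U B L \<phi>"
    and smooth: "smoothly_trivialized X C S U B L CC \<phi>"
    and cone: "has_bump_functions (open_cone (top_of L) 1) CC"
    and W: "openin (top_of X) W" "x \<in> W"
  shows "\<exists>f\<in>C. (\<forall>y\<in>topspace (top_of X). 0 \<le> f y) \<and> 0 < f x \<and>
    (\<forall>y\<in>topspace (top_of X) - W. f y = 0)"
proof -
  let ?Y = "top_of X" and ?cL = "open_cone (top_of L) 1"
  let ?P = "prod_topology (subtopology ?Y B) ?cL"
  have U: "openin ?Y U" "x \<in> U" and homeo: "homeomorphic_map (subtopology ?Y U) ?P \<phi>"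
    and ball: "open_ball_around (subtopology ?Y S) (sdim X S) (atlas X S) x B"
    using triv by (auto simp: local_trivialization_def)
  obtain \<psi> where chart: "compatible_chart (subtopology ?Y S) (sdim X S) (atlas X S) (B, \<psi>)"
    using ball by (auto simp: open_ball_around_def)
  then have "openin (subtopology ?Y S) B"
    by (simp add: compatible_chart_def is_chart_def split_beta)
  then have "B \<subseteq> S"
    using openin_imp_subset by blast
  then have subB: "subtopology (subtopology ?Y S) B = subtopology ?Y B"
    by (simp add: subtopology_subtopology Int_absorb1)
  \<comment> \<open>The closed set \<open>K\<close> inside \<open>U\<close> is what permits
    continuation by zero: \<open>U\<close> and the complement of \<open>K\<close> cover the
    space.\<close>
  obtain V K where V: "openin ?Y V" "x \<in> V" "V \<subseteq> K" and K: "closedin ?Y K" "K \<subseteq> W \<inter> U"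
    using regular_space_nhd[OF reg, of "W \<inter> U" x] W U by (metis IntI openin_Int)
  have topU: "topspace (subtopology ?Y U) = U"
    using U(1) openin_subset by (auto)
  have inj: "inj_on \<phi> U"
    using homeomorphic_imp_injective_map[OF homeo] topU by simp
  have img: "\<phi> ` U = topspace ?P"
    using homeomorphic_imp_surjective_map[OF homeo] topU by simp
  have topP: "topspace ?P \<subseteq> B \<times> topspace ?cL"
    by auto
  have \<phi>_in: "\<phi> y \<in> B \<times> topspace ?cL" if "y \<in> U" for y
    using imageI[OF that, of \<phi>] topP unfolding img by (rule subsetD[rotated])
  have "openin (subtopology ?Y U) V"
    using V K by (auto simp: openin_open_subtopology[OF U(1)])
  then have "openin ?P (\<phi> ` V)"
    using homeomorphic_map_openness[OF homeo, of V] V K topU by auto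
  moreover obtain b c where bc: "\<phi> x = (b, c)"
    by force
  ultimately obtain B1 D1 where D1: "openin (subtopology ?Y B) B1" "openin ?cL D1" "b \<in> B1" "c \<in> D1"
    and sub: "B1 \<times> D1 \<subseteq> \<phi> ` V"
    using V(2) unfolding openin_prod_topology_alt by (metis image_eqI)
  obtain \<beta> where \<beta>: "\<beta> \<in> manifold_smooth_functions (sdim X S) (atlas X S) B" "\<And>y. 0 \<le> \<beta> y" "0 < \<beta> b"
    "\<And>y. y \<in> B \<Longrightarrow> y \<notin> B1 \<Longrightarrow> \<beta> y = 0"
    using compatible_chart_bump[OF chart, of B1 b] D1 subB by auto
  obtain \<gamma> where \<gamma>: "\<gamma> \<in> CC" "\<And>y. y \<in> topspace ?cL \<Longrightarrow> 0 \<le> \<gamma> y" "0 < \<gamma> c"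
    "\<And>y. y \<in> topspace ?cL \<Longrightarrow> y \<notin> D1 \<Longrightarrow> \<gamma> y = 0"
    using cone D1(2,4) unfolding has_bump_functions_def by (metis DiffI)
  define F where "F = (\<lambda>(y\<^sub>1, y\<^sub>2). \<beta> y\<^sub>1 * \<gamma> y\<^sub>2)"
  have "F \<in> product_smooth_structure (subtopology ?Y B)
      (manifold_smooth_functions (sdim X S) (atlas X S) B) ?cL CC"
    unfolding F_def using \<beta>(1) \<gamma>(1) by (rule product_smooth_structure_mult)
  then have sec: "(\<lambda>y. F (\<phi> y)) \<in> sections_on ?Y C U"
    using smooth by (auto simp: smoothly_trivialized_def pullback_on_def)
  have F0: "F (\<phi> y) = 0" if "y \<in> U" "y \<notin> V" for y
  proof -
    have "V \<subseteq> U"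
      using V(3) K(2) by blast
    then have "\<phi> y \<notin> \<phi> ` V"
      using inj_on_image_mem_iff[OF inj that(1)] that(2) by blast
    then have "\<phi> y \<notin> B1 \<times> D1"
      by (rule contra_subsetD[OF sub])
    moreover have "\<phi> y \<in> B \<times> topspace ?cL"
      using that(1) by (rule \<phi>_in)
    moreover obtain y\<^sub>1 y\<^sub>2 where "\<phi> y = (y\<^sub>1, y\<^sub>2)"
      by (rule prod.exhaust)
    ultimately show ?thesis
      using \<beta>(4)[of y\<^sub>1] \<gamma>(4)[of y\<^sub>2] by (auto simp: F_def)
  qed
  \<comment> \<open>By \<open>F0\<close> the pulled-back product already vanishes on
    \<open>U - V\<close>, so \<open>f\<close> agrees with it on all of \<open>U\<close>, and with 0
    off \<open>K\<close>.\<close>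
  define f where "f y = (if y \<in> V then F (\<phi> y) else 0)" for y
  have fU: "f y = F (\<phi> y)" if "y \<in> U" for y
    using F0[OF that] by (simp add: f_def)
  show ?thesis
  proof (intro bexI conjI ballI)
    show "f \<in> C"
    proof (rule germ_defined_algebra_local[OF C])
      fix y assume y: "y \<in> topspace ?Y"
      show "\<exists>W g. openin ?Y W \<and> y \<in> W \<and> g \<in> C \<and> (\<forall>z\<in>W. f z = g z)"
      proof (cases "y \<in> U")
        case True
        then obtain W' g where "openin ?Y W'" "y \<in> W'" "W' \<subseteq> U" "g \<in> C" "\<forall>z\<in>W'. F (\<phi> z) = g z"
          using sec unfolding sections_on_def by blast
        then show ?thesis
          by (intro exI[of _ W'] exI[of _ g]) (simp add: fU subset_iff)
      next
        case False
        then show ?thesis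
          using y V K germ_defined_algebra_const[OF C, of 0]
          by (intro exI[of _ "topspace ?Y - K"] exI[of _ "\<lambda>_. 0"]) (auto simp: f_def)
      qed
    qed
    show "0 < f x"
      using V(2) \<beta>(3) \<gamma>(3) bc by (simp add: f_def F_def)
    show "f y = 0" if "y \<in> topspace ?Y - W" for y
      using that V K by (auto simp: f_def)
    show "0 \<le> f y" if "y \<in> topspace ?Y" for y
    proof (cases "y \<in> V")
      case True
      then have "\<phi> y \<in> B \<times> topspace ?cL"
        using V(3) K(2) by (intro \<phi>_in) blast
      moreover obtain y\<^sub>1 y\<^sub>2 where "\<phi> y = (y\<^sub>1, y\<^sub>2)"
        by (rule prod.exhaust)
      ultimately show ?thesis
        using True \<beta>(2)[of y\<^sub>1] \<gamma>(2)[of y\<^sub>2] by (simp add: f_def F_def)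
    qed (simp add: f_def)
  qed
qed

section \<open>Cones\<close>

lemma cone_class_pos: "0 < snd p \<Longrightarrow> cone_class K p = {p}"
  and cone_class_0: "cone_class K (z, 0) = cone_vertex K"
  by (simp_all add: cone_class_def)

text \<open>The only member of the class has positive height. This also covers empty
  \<open>K\<close>, where the vertex is the empty set.\<close>

lemma cone_class_neq_vertex:
  assumes "0 < snd p"
  shows "cone_class K p \<noteq> cone_vertex K"
proof
  assume "cone_class K p = cone_vertex K"
  then have "p \<in> topspace K \<times> {0}"
    using assms by (simp add: cone_class_pos cone_vertex_def) (metis insertI1)
  then show False
    using assms by auto
qed

lemma cone_class_eq_iff:
  assumes "0 \<le> snd p" and "0 \<le> snd q"
  shows "cone_class K p = cone_class K q \<longleftrightarrow> p = q \<or> snd p = 0 \<and> snd q = 0"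
proof (cases "snd p = 0")
  case True
  then have "cone_class K p = cone_vertex K"
    by (simp add: cone_class_def)
  then show ?thesis
    using True assms cone_class_neq_vertex[of q K] by (cases "snd q = 0") (auto simp: cone_class_def)
next
  case False
  then have "0 < snd p"
    using assms by simp
  then show ?thesis
    using assms cone_class_neq_vertex[of p K] by (cases "snd q = 0") (auto simp: cone_class_def)
qed

lemma cone_class_in_cone_below_iff:
  assumes "z \<in> topspace K" and "0 \<le> t" and "0 < \<tau>"
  shows "cone_class K (z, t) \<in> cone_below K \<tau> \<longleftrightarrow> t < \<tau>"
proof (cases "t = 0")
  case True
  then show ?thesis
    using assms by (simp add: cone_class_0 cone_below_def)
next
  case False
  then have "cone_class K (z, t) \<noteq> cone_vertex K" "cone_class K (z, t) = {(z, t)}"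
    using assms cone_class_neq_vertex[of "(z, t)" K] by (simp_all add: cone_class_pos)
  moreover have "cone_class K ` (topspace K \<times> {0<..<\<tau>}) = (\<lambda>p. {p}) ` (topspace K \<times> {0<..<\<tau>})"
    by (intro image_cong refl cone_class_pos) (simp add: mem_Times_iff)
  ultimately show ?thesis
    using assms False by (simp add: cone_below_def image_iff)
qed

lemma cone_below_cases:
  assumes "c \<in> cone_below K \<tau>"
  obtains "c = cone_vertex K"
  | z t where "c = cone_class K (z, t)" "z \<in> topspace K" "0 < t" "t < \<tau>"
  using assms by (auto simp: cone_below_def)

lemma cone_below_subset_points: "cone_below K \<tau> \<subseteq> cone_points K"
  by (auto simp: cone_below_def cone_points_def)

lemma topspace_cone_topology: "topspace (cone_topology K) = cone_points K"
proof (rule antisym)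
  show "topspace (cone_topology K) \<subseteq> cone_points K"
    using openin_cone_topology[of K "topspace (cone_topology K)"] by simp
  have "{p \<in> topspace K \<times> {0..}. cone_class K p \<in> cone_points K} =
      topspace (prod_topology K (top_of_set {0::real..}))"
    by (auto simp: cone_points_def)
  then have "openin (cone_topology K) (cone_points K)"
    unfolding openin_cone_topology by (simp only: openin_topspace order_refl simp_thms)
  then show "cone_points K \<subseteq> topspace (cone_topology K)"
    by (rule openin_subset)
qed

lemma topspace_open_cone: "topspace (open_cone K \<epsilon>) = cone_below K \<epsilon>"
  using cone_below_subset_points[of K \<epsilon>]
  by (auto simp: open_cone_def topspace_cone_topology)

lemma openin_open_coneI:
  assumes "W \<subseteq> cone_below K \<epsilon>"
    and "openin (prod_topology K (top_of_set {0..})) {p \<in> topspace K \<times> {0..}. cone_class K p \<in> W}"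
  shows "openin (open_cone K \<epsilon>) W"
proof -
  have "openin (cone_topology K) W"
    using assms cone_below_subset_points[of K \<epsilon>] by (simp add: openin_cone_topology)
  then show ?thesis
    unfolding open_cone_def openin_subtopology using assms(1) by blast
qed

lemma openin_open_cone_below:
  assumes "0 < \<tau>" and "\<tau> \<le> \<epsilon>"
  shows "openin (open_cone K \<epsilon>) (cone_below K \<tau>)"
proof (rule openin_open_coneI)
  show "cone_below K \<tau> \<subseteq> cone_below K \<epsilon>"
    using assms(2) by (force simp: cone_below_def)
  have "{p \<in> topspace K \<times> {0..}. cone_class K p \<in> cone_below K \<tau>} = topspace K \<times> {0..<\<tau>}"
    using assms(1) by (auto simp: cone_class_in_cone_below_iff)
  moreover have "openin (top_of_set {0..}) {0..<\<tau>}"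
    using openin_open_Int[OF open_lessThan, of "{0..}" \<tau>] atLeastLessThan_def[of 0 \<tau>] by simp
  ultimately show "openin (prod_topology K (top_of_set {0..}))
      {p \<in> topspace K \<times> {0..}. cone_class K p \<in> cone_below K \<tau>}"
    by (simp add: openin_prod_Times_iff)
qed

lemma openin_open_cone_above:
  assumes "0 \<le> \<tau>"
  shows "openin (open_cone K \<epsilon>) (cone_class K ` (topspace K \<times> {\<tau><..<\<epsilon>}))"
proof (rule openin_open_coneI)
  show "cone_class K ` (topspace K \<times> {\<tau><..<\<epsilon>}) \<subseteq> cone_below K \<epsilon>"
    using assms by (force simp: cone_below_def)
  have "{p \<in> topspace K \<times> {0..}. cone_class K p \<in> cone_class K ` (topspace K \<times> {\<tau><..<\<epsilon>})} =
      topspace K \<times> {\<tau><..<\<epsilon>}" (is "?l = ?r")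
  proof (rule antisym)
    show "?l \<subseteq> ?r"
    proof
      fix p assume "p \<in> ?l"
      then obtain q where q: "q \<in> ?r" "cone_class K p = cone_class K q" and "0 \<le> snd p"
        by auto
      moreover have "0 < snd q"
        using q(1) assms by auto
      ultimately have "p = q"
        by (simp add: cone_class_eq_iff)
      with q(1) show "p \<in> ?r"
        by simp
    qed
    have "topspace K \<times> {\<tau><..<\<epsilon>} \<subseteq> topspace K \<times> {0..}"
      using assms by auto
    then show "?r \<subseteq> ?l"
      by blast
  qed
  moreover have "openin (top_of_set {0..}) {\<tau><..<\<epsilon>}"
    using assms by (intro open_subset) auto
  ultimately show "openin (prod_topology K (top_of_set {0..}))
      {p \<in> topspace K \<times> {0..}. cone_class K p \<in> cone_class K ` (topspace K \<times> {\<tau><..<\<epsilon>})}"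
    by (simp add: openin_prod_Times_iff)
qed

section \<open>Bump functions at the vertex of a cone\<close>

text \<open>Compactness of the link enters through the tube lemma: a neighbourhood of the bottom
  \<open>topspace K \<times> {0}\<close> contains a strip of one height over all of
  \<open>K\<close>.\<close>

lemma open_cone_vertex_nhd:
  assumes "compact_space K" and "openin (open_cone K 1) W" and "cone_vertex K \<in> W"
  obtains \<epsilon> where "0 < \<epsilon>" and "\<epsilon> \<le> 1" and "cone_below K \<epsilon> \<subseteq> W"
proof -
  obtain W' where W': "openin (cone_topology K) W'" "W = W' \<inter> cone_below K 1"
    using assms(2) by (auto simp: open_cone_def openin_subtopology)
  let ?P = "{p \<in> topspace K \<times> {0..}. cone_class K p \<in> W'}"
  have "openin (prod_topology K (top_of_set {0..})) ?P"
    using W'(1) by (simp add: openin_cone_topology)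
  moreover have "topspace K \<times> {0} \<subseteq> ?P"
    using assms(3) W'(2) by (auto simp: cone_class_0)
  ultimately obtain U V where UV: "openin (top_of_set {0..}) V" "topspace K \<subseteq> U" "0 \<in> V"
    "U \<times> V \<subseteq> ?P"
    using tube_lemma_left[of K "top_of_set {0..}" ?P "topspace K" 0] assms(1)
    by (auto simp: compact_space_def)
  obtain e where e: "0 < e" "\<forall>t\<in>{0..}. dist t 0 < e \<longrightarrow> t \<in> V"
    using UV(1,3) unfolding openin_euclidean_subtopology_iff by blast
  \<comment> \<open>The cap at 1 is due to \<open>W\<close> being the trace of \<open>W'\<close> on
    \<open>cone_below K 1\<close>.\<close>
  show thesis
  proof (rule that[of "min e 1"])
    show "cone_below K (min e 1) \<subseteq> W"
    proof
      fix c assume "c \<in> cone_below K (min e 1)"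
      then consider "c = cone_vertex K"
        | z t where "c = cone_class K (z, t)" "z \<in> topspace K" "0 < t" "t < e" "t < 1"
        by (auto simp: cone_below_def)
      then show "c \<in> W"
      proof cases
        case 2
        then have "t \<in> V" "z \<in> U"
          using e(2) UV(2) by auto
        then have "(z, t) \<in> ?P"
          using UV(4) by blast
        then show ?thesis
          using 2 W'(2) cone_class_in_cone_below_iff[of z K t 1] by simp
      qed (simp add: assms(3))
    qed
  qed (use e(1) in auto)
qed

text \<open>Condition (3b) only provides radial functions that vanish near the vertex. Given such an \<open>F\<close>,
  the function \<open>flat_exp (c - F)\<close> is a positive constant near the vertex and vanishes where
  \<open>F \<ge> c\<close>, here for \<open>2a < t < 3a\<close>, so that it can be continued by zero from there on.\<close>

lemma cone_vertex_bump:
  assumes "compact_space K" and CC: "germ_defined_algebra (open_cone K 1) CC"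
    and radial: "cone_contains_radial K CC"
    and W: "openin (open_cone K 1) W" "cone_vertex K \<in> W"
  shows "\<exists>f\<in>CC. (\<forall>y\<in>topspace (open_cone K 1). 0 \<le> f y) \<and> 0 < f (cone_vertex K) \<and>
    (\<forall>y\<in>topspace (open_cone K 1) - W. f y = 0)"
proof -
  obtain \<epsilon> where \<epsilon>: "0 < \<epsilon>" "\<epsilon> \<le> 1" "cone_below K \<epsilon> \<subseteq> W"
    using open_cone_vertex_nhd[OF assms(1) W] by blast
  \<comment> \<open>With a fifth of \<epsilon>, the interval [a, 4a] carrying \<open>u\<close> lies
    inside (0, 1), and its middle third [2a, 3a] stays below \<epsilon>.\<close>
  define a where "a = \<epsilon> / 5"
  have a: "0 < a" "4 * a < 1" "3 * a \<le> \<epsilon>" "3 * a \<le> 1"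
    using \<epsilon> by (auto simp: a_def)
  define u where "u t = flat_exp ((t - a) * (4 * a - t))" for t
  define F where "F c = (if c = cone_vertex K then 0 else u (snd (the_elem c)))" for c
  have F_class: "F (cone_class K (z, t)) = u t" if "0 < t" for z t
    using that cone_class_neq_vertex[of "(z, t)" K] by (simp add: F_def cone_class_pos)
  have "smooth_real u"
    unfolding u_def by (intro smooth_real_flat_exp smooth_real_intros)
  moreover have "u t = 0" if "t \<notin> {a..4 * a}" for t
  proof -
    have "(t - a) * (4 * a - t) \<le> 0"
    proof (cases "t < a")
      case True
      then show ?thesis
        using a(1) by (intro mult_nonpos_nonneg) auto
    next
      case False
      then show ?thesis
        using that by (intro mult_nonneg_nonpos) auto
    qed
    then show ?thesis
      unfolding u_def by (rule flat_exp_eq_0)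
  qed
  moreover have "F (cone_vertex K) = 0"
    by (simp add: F_def)
  moreover have "{a..4 * a} \<subseteq> {0<..<1}"
    using a by auto
  ultimately have "F \<in> CC"
    using radial[unfolded cone_contains_radial_def, rule_format, of u "{a..4 * a}" F] F_class
    by (simp add: smooth_real_imp_smooth_real_on)
  moreover have "smooth_real (\<lambda>t. flat_exp (flat_exp (2 * a * a) - t))"
    by (intro smooth_real_flat_exp smooth_real_intros)
  ultimately have G_CC: "(\<lambda>c. flat_exp (flat_exp (2 * a * a) - F c)) \<in> CC"
    using germ_defined_algebra_compose[OF CC] by blast
  \<comment> \<open>The quadratic inside \<open>u\<close> equals \<open>2 * a * a\<close> at both 2a
    and 3a and exceeds it in between by \<open>(t - 2 * a) * (3 * a - t)\<close>. This is the origin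
    of the threshold \<open>flat_exp (2 * a * a)\<close>.\<close>
  have u_ge: "flat_exp (2 * a * a) \<le> u t" if "2 * a < t" "t < 3 * a" for t
  proof -
    have "0 \<le> (t - 2 * a) * (3 * a - t)"
      using that by simp
    then show ?thesis
      unfolding u_def by (intro flat_exp_mono) (simp add: algebra_simps)
  qed
  define \<gamma> where
    "\<gamma> c = (if c \<in> cone_below K (3 * a) then flat_exp (flat_exp (2 * a * a) - F c) else 0)" for c
  show ?thesis
  proof (intro bexI conjI ballI)
    show "\<gamma> \<in> CC"
    proof (rule germ_defined_algebra_local[OF CC])
      fix c assume c: "c \<in> topspace (open_cone K 1)"
      show "\<exists>W g. openin (open_cone K 1) W \<and> c \<in> W \<and> g \<in> CC \<and> (\<forall>y\<in>W. \<gamma> y = g y)"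
      proof (cases "c \<in> cone_below K (3 * a)")
        case True
        then show ?thesis
          using G_CC a openin_open_cone_below[of "3 * a" 1 K]
          by (intro exI[of _ "cone_below K (3 * a)"]
              exI[of _ "\<lambda>c. flat_exp (flat_exp (2 * a * a) - F c)"])
            (simp add: \<gamma>_def)
      next
        case False
        \<comment> \<open>This open set meets \<open>cone_below K (3 * a)\<close> only in the band
          2a < t < 3a, where \<open>u_ge\<close> makes the inner formula vanish as well.\<close>
        let ?W = "cone_class K ` (topspace K \<times> {2 * a<..<1})"
        obtain z t where zt: "c = cone_class K (z, t)" "z \<in> topspace K" "0 < t" "t < 1"
          using c False unfolding topspace_open_cone
          by (elim cone_below_cases) (auto simp: cone_below_def)
        then have "3 * a \<le> t"
          using False a cone_class_in_cone_below_iff[of z K t "3 * a"] by auto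
        then have "c \<in> ?W"
          using zt a by auto
        moreover have "\<gamma> y = 0" if y: "y \<in> ?W" for y
        proof -
          obtain w s where ws: "y = cone_class K (w, s)" "w \<in> topspace K" "2 * a < s"
            using y by auto
          then have "0 < s"
            using a by simp
          with ws have "y \<in> cone_below K (3 * a) \<longleftrightarrow> s < 3 * a" and "F y = u s"
            using a F_class by (simp_all add: cone_class_in_cone_below_iff)
          then show ?thesis
            using u_ge[of s] ws(3) by (simp add: \<gamma>_def flat_exp_eq_0)
        qed
        ultimately show ?thesis
          using openin_open_cone_above[of "2 * a" K 1] a germ_defined_algebra_const[OF CC, of 0]
          by (intro exI[of _ ?W] exI[of _ "\<lambda>_. 0"]) simp
      qed
    qed
    show "0 \<le> \<gamma> y" for y
      by (simp add: \<gamma>_def flat_exp_nonneg)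
    show "0 < \<gamma> (cone_vertex K)"
      using a by (simp add: \<gamma>_def cone_below_def F_def flat_exp_pos_iff)
    show "\<gamma> y = 0" if "y \<in> topspace (open_cone K 1) - W" for y
    proof -
      have "cone_below K (3 * a) \<subseteq> cone_below K \<epsilon>"
        using a(3) by (force simp: cone_below_def)
      then show ?thesis
        using that \<epsilon>(3) by (auto simp: \<gamma>_def)
    qed
  qed
qed

section \<open>Regularity of cones over compact Hausdorff spaces\<close>

text \<open>Only the closed and compact bottom is collapsed. Fibres are therefore points or the
  bottom, and saturating a closed set adds at most the bottom. For empty \<open>K\<close>
  surjectivity fails, since the vertex is then the class of no pair.\<close>

lemma perfect_map_cone_class:
  assumes "compact_space K" and "topspace K \<noteq> {}"
  shows "perfect_map (prod_topology K (top_of_set {0..})) (cone_topology K) (cone_class K)"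
proof -
  let ?P = "prod_topology K (top_of_set {0::real..})"
  have top: "topspace ?P = topspace K \<times> {0..}"
    by simp
  have closed0: "closedin ?P (topspace K \<times> {0})"
    by (auto simp: closedin_prod_Times_iff closed_subset)
  have compact0: "compactin ?P (topspace K \<times> {0})"
    using assms(1) by (auto simp: compactin_Times compact_space_def compactin_subtopology)
  have eq_iff: "cone_class K p = cone_class K q \<longleftrightarrow> p = q \<or> snd p = 0 \<and> snd q = 0"
    if "p \<in> topspace ?P" "q \<in> topspace ?P" for p q
    using that by (intro cone_class_eq_iff) auto
  have maps: "cone_class K p \<in> cone_points K" if "p \<in> topspace ?P" for p
    using that unfolding cone_points_def top by blast
  have "continuous_map ?P (cone_topology K) (cone_class K)"
    unfolding continuous_map_def topspace_cone_topology openin_cone_topology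
    using maps by (auto simp: Pi_iff)
  moreover have surj: "cone_class K ` topspace ?P = cone_points K"
  proof -
    obtain z where "z \<in> topspace K"
      using assms(2) by blast
    then have "cone_vertex K \<in> cone_class K ` topspace ?P"
      unfolding top by (metis SigmaI atLeast_iff cone_class_0 image_eqI order_refl)
    then show ?thesis
      by (auto simp: cone_points_def)
  qed
  moreover have "closed_map ?P (cone_topology K) (cone_class K)"
    unfolding closed_map_def
  proof (intro allI impI)
    fix S assume S: "closedin ?P S"
    then have subS: "S \<subseteq> topspace ?P"
      by (rule closedin_subset)
    \<comment> \<open>What saturation adds to \<open>S\<close>: the whole bottom as soon as
      \<open>S\<close> meets it.\<close>
    let ?Z = "if S \<inter> topspace K \<times> {0} = {} then {} else topspace K \<times> {0}"
    have "{p \<in> topspace K \<times> {0..}. cone_class K p \<in> cone_points K - cone_class K ` S} =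
        topspace ?P - (S \<union> ?Z)" (is "?l = ?r")
    proof (rule set_eqI)
      fix p
      have "cone_class K p \<in> cone_class K ` S \<longleftrightarrow> p \<in> S \<union> ?Z" if p: "p \<in> topspace ?P"
      proof -
        have "cone_class K p \<in> cone_class K ` S \<longleftrightarrow> (\<exists>q\<in>S. p = q \<or> snd p = 0 \<and> snd q = 0)"
          using eq_iff[OF p] subS by (auto simp: image_iff)
        also have "\<dots> \<longleftrightarrow> p \<in> S \<union> ?Z"
        proof -
          have "p \<in> topspace K \<times> {0} \<longleftrightarrow> snd p = 0"
            using p by (auto simp: mem_Times_iff)
          moreover have "S \<inter> topspace K \<times> {0} = {} \<longleftrightarrow> \<not> (\<exists>q\<in>S. snd q = 0)"
            using subS by (fastforce simp: mem_Times_iff)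
          ultimately show ?thesis
            by auto
        qed
        finally show ?thesis .
      qed
      then show "p \<in> ?l \<longleftrightarrow> p \<in> ?r"
        using maps[of p] unfolding top by blast
    qed
    moreover have "closedin ?P (S \<union> ?Z)"
      using S closed0 by auto
    ultimately have "openin (cone_topology K) (cone_points K - cone_class K ` S)"
      unfolding openin_cone_topology by (simp only: closedin_def Diff_subset)
    moreover have "cone_class K ` S \<subseteq> cone_points K"
      using subS maps by blast
    ultimately show "closedin (cone_topology K) (cone_class K ` S)"
      by (simp add: closedin_def topspace_cone_topology)
  qed
  moreover have "compactin ?P {p \<in> topspace ?P. cone_class K p = c}" if "c \<in> cone_points K" for c
  proof -
    have "c \<in> cone_class K ` topspace ?P"
      using that by (simp only: surj)
    then obtain q where q: "c = cone_class K q" "q \<in> topspace ?P"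
      by (rule imageE)
    have fibre: "{p \<in> topspace ?P. cone_class K p = c} =
        {p \<in> topspace ?P. p = q \<or> snd p = 0 \<and> snd q = 0}"
      by (intro Collect_cong conj_cong refl) (simp only: q(1) eq_iff[OF _ q(2)])
    show ?thesis
    proof (cases "snd q = 0")
      case True
      then have "{p \<in> topspace ?P. cone_class K p = c} = topspace K \<times> {0}"
        using q(2) unfolding fibre unfolding top by (auto simp: mem_Times_iff)
      then show ?thesis
        using compact0 by simp
    next
      case False
      then have "{p \<in> topspace ?P. cone_class K p = c} = {q}"
        using q(2) unfolding fibre by blast
      then show ?thesis
        using q(2) by (simp only: compactin_sing)
    qed
  qed
  ultimately show ?thesis
    by (simp add: perfect_map_def proper_map_def topspace_cone_topology)
qed

text \<open>Regularity passes to products, perfect images and subspaces. It licenses continuation by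
  zero on the cone.\<close>

lemma regular_space_open_cone:
  assumes "compact_space K" and "Hausdorff_space K" and "topspace K \<noteq> {}"
  shows "regular_space (open_cone K \<epsilon>)"
proof -
  have "regular_space (top_of_set {0::real..})"
    by (intro regular_space_subtopology regular_space_euclidean)
  then have "regular_space (prod_topology K (top_of_set {0::real..}))"
    using compact_Hausdorff_imp_regular_space[OF assms(1,2)] by (simp add: regular_space_prod_topology)
  then have "regular_space (cone_topology K)"
    using perfect_map_cone_class[OF assms(1,3)] by (rule regular_space_perfect_map_image)
  then show ?thesis
    unfolding open_cone_def by (rule regular_space_subtopology)
qed

lemma top_of_cone_decomposition: "top_of (cone_decomposition L) = open_cone (top_of L) 1"
  and strata_cone_decomposition: "strata (cone_decomposition L) = insert {cone_vertex (top_of L)}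
    ((\<lambda>S. cone_class (top_of L) ` (S \<times> {0<..<1})) ` strata L)"
  by (simp_all add: cone_decomposition_def Let_def)

lemma stratified_space_imp_decomposed_space: "stratified_space X \<Longrightarrow> decomposed_space X"
  by (erule stratified_space.cases) simp

section \<open>Existence of bump functions on cones and on stratified spaces\<close>

lemma smooth_cone_has_bump_functions:
  fixes L :: "'a decomposition"
  assumes "smooth_cone L CL CC"
  shows "has_bump_functions (open_cone (top_of L) 1) CC"
  using assms
\<comment> \<open>Smooth structures get the trivial claim: local triviality of a cone off its vertex
  refers directly to other cones, so the induction hypothesis has to speak of cones only.\<close>
proof (induction rule: smooth_structure_smooth_cone.inducts(2)[where ?P1.0 = "\<lambda>_ _. True"])
  case (smooth_coneI L CL CC)
  let ?K = "top_of L"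
  have dec: "Hausdorff_space ?K" "\<Union>(strata L) = topspace ?K"
    using stratified_space_imp_decomposed_space[OF smooth_coneI(1)]
    by (simp_all add: decomposed_space_def)
  show ?case
    unfolding has_bump_functions_def
  proof (intro allI impI, elim conjE)
    fix W c assume W: "openin (open_cone ?K 1) W" "c \<in> W"
    have "c \<in> topspace (open_cone ?K 1)"
      using openin_subset[OF W(1)] W(2) by (rule subsetD)
    then have "c \<in> cone_below ?K 1"
      by (simp only: topspace_open_cone)
    then show "\<exists>f\<in>CC. (\<forall>y\<in>topspace (open_cone ?K 1). 0 \<le> f y) \<and> 0 < f c \<and>
        (\<forall>y\<in>topspace (open_cone ?K 1) - W. f y = 0)"
    proof (cases rule: cone_below_cases)
      case 1
      then show ?thesis
        using cone_vertex_bump[OF \<open>compact_space ?K\<close> \<open>germ_defined_algebra _ CC\<close>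
            \<open>cone_contains_radial ?K CC\<close> W(1)] W(2) by simp
    next
      case (2 z t)
      note compact = \<open>compact_space ?K\<close>
      obtain S where S: "S \<in> strata L" "z \<in> S"
        using 2(2) dec(2) by blast
      let ?T = "cone_class ?K ` (S \<times> {0<..<1})"
      have cT: "c \<in> ?T"
        using 2 S(2) by (intro image_eqI[of _ _ "(z, t)"]) auto
      moreover have "c \<noteq> cone_vertex ?K"
        using 2 cone_class_neq_vertex[of "(z, t)" ?K] by simp
      ultimately have "?T \<in> strata (cone_decomposition L) - {{cone_vertex ?K}}"
        using S(1) unfolding strata_cone_decomposition by blast
      then obtain U B and L' :: "'a decomposition" and \<phi> CC'
        where triv: "local_trivialization (cone_decomposition L) ?T c U B L' \<phi>"
        and bump: "has_bump_functions (open_cone (top_of L') 1) CC'"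
        and smooth: "smoothly_trivialized (cone_decomposition L) CC ?T U B L' CC' \<phi>"
        using \<open>\<forall>S\<in>strata (cone_decomposition L) - {{cone_vertex ?K}}. _\<close> cT by meson
      \<comment> \<open>The point z witnesses that the link is nonempty, as regularity of its cone
        demands.\<close>
      have "regular_space (open_cone ?K 1)"
        using compact dec(1) 2(2) by (intro regular_space_open_cone) auto
      then show ?thesis
        using local_trivialization_bump[OF _ _ triv smooth bump, of W]
          \<open>germ_defined_algebra (open_cone ?K 1) CC\<close> W
        by (simp add: top_of_cone_decomposition)
    qed
  qed
qed simp

text \<open>The argument in a chart is the one used off the vertex of a cone. Regularity is a
  premise here, to be supplied by the cover in the theorem.\<close>

lemma smooth_structure_has_bump_functions:
  fixes X :: "'a decomposition"
  assumes "smooth_structure X C" and "regular_space (top_of X)"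
  shows "has_bump_functions (top_of X) C"
  using assms(1)
proof (cases rule: smooth_structure.cases)
  case smooth_structureI
  have "\<Union>(strata X) = topspace (top_of X)"
    using stratified_space_imp_decomposed_space[OF smooth_structureI(1)]
    by (simp add: decomposed_space_def)
  show ?thesis
    unfolding has_bump_functions_def
  proof (intro allI impI, elim conjE)
    fix W x assume W: "openin (top_of X) W" "x \<in> W"
    then have "x \<in> \<Union>(strata X)"
      using openin_subset \<open>\<Union>(strata X) = _\<close> by blast
    then obtain S where S: "S \<in> strata X" "x \<in> S"
      by blast
    with smooth_structureI(3) obtain U B and L :: "'a decomposition" and \<phi> CL CC
      where "local_trivialization X S x U B L \<phi>" "smooth_cone L CL CC"
        "smoothly_trivialized X C S U B L CC \<phi>"
      by meson
    then show "\<exists>f\<in>C. (\<forall>y\<in>topspace (top_of X). 0 \<le> f y) \<and> 0 < f x \<and>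
        (\<forall>y\<in>topspace (top_of X) - W. f y = 0)"
      using local_trivialization_bump[OF smooth_structureI(2) assms(2)] smooth_cone_has_bump_functions W
      by blast
  qed
qed

section \<open>Partitions of unity\<close>

text \<open>Finitely many of the neighbourhoods witnessing local finiteness cover \<open>K\<close>,
  and each of them meets finitely many \<open>U i\<close>.\<close>

lemma locally_finite_open_cover_finite_meeting_compact:
  assumes "locally_finite_open_cover X I U" and "compactin X K"
  shows "finite {i \<in> I. U i \<inter> K \<noteq> {}}"
proof -
  have "\<forall>x\<in>topspace X. \<exists>V. openin X V \<and> x \<in> V \<and> finite {i \<in> I. U i \<inter> V \<noteq> {}}"
    using assms(1) by (simp add: locally_finite_open_cover_def)
  then obtain V where V: "\<forall>x\<in>topspace X.
      openin X (V x) \<and> x \<in> V x \<and> finite {i \<in> I. U i \<inter> V x \<noteq> {}}"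
    by (rule exE[OF bchoice])
  have K: "K \<subseteq> topspace X"
    using assms(2) by (rule compactin_subset_topspace)
  then have "K \<subseteq> \<Union>(V ` K)" "\<And>W. W \<in> V ` K \<Longrightarrow> openin X W"
    using V by blast+
  then obtain \<F> where "finite \<F>" "\<F> \<subseteq> V ` K" "K \<subseteq> \<Union>\<F>"
    using compactinD[OF assms(2)] by meson
  then obtain T where T: "finite T" "T \<subseteq> K" "K \<subseteq> \<Union>(V ` T)"
    using finite_subset_image by metis
  then have "finite (\<Union>x\<in>T. {i \<in> I. U i \<inter> V x \<noteq> {}})"
    using V K by blast
  moreover have "{i \<in> I. U i \<inter> K \<noteq> {}} \<subseteq> (\<Union>x\<in>T. {i \<in> I. U i \<inter> V x \<noteq> {}})"
    using T(3) by blast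
  ultimately show ?thesis
    by (rule finite_subset[rotated])
qed

text \<open>A bump vanishing off \<open>V\<close> has its closed support inside the closed set
  \<open>K\<close> between \<open>V\<close> and \<open>W\<close>.\<close>

lemma bump_function_support:
  assumes "has_bump_functions X C" and "regular_space X" and "openin X W" and "x \<in> W"
  obtains f where "f \<in> C" and "\<And>y. y \<in> topspace X \<Longrightarrow> 0 \<le> f y" and "0 < f x"
    and "support_in X f \<subseteq> W"
proof -
  obtain V K where V: "openin X V" "closedin X K" "x \<in> V" "V \<subseteq> K" "K \<subseteq> W"
    using assms(2-4) by (rule regular_space_nhd)
  obtain f where f: "f \<in> C" "\<forall>y\<in>topspace X. 0 \<le> f y" "0 < f x" "\<forall>y\<in>topspace X - V. f y = 0"
    using assms(1) V(1,3) unfolding has_bump_functions_def by meson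
  have "{y \<in> topspace X. f y \<noteq> 0} \<subseteq> K"
    using f(4) V(4) by blast
  then have "support_in X f \<subseteq> K"
    unfolding support_in_def using V(2) by (rule closure_of_minimal)
  then have "support_in X f \<subseteq> W"
    using V(5) by (rule order_trans)
  then show thesis
    using f by (intro that) auto
qed

lemma support_in_superset: "x \<in> topspace X \<Longrightarrow> f x \<noteq> 0 \<Longrightarrow> x \<in> support_in X f"
  unfolding support_in_def by (rule subsetD[OF closure_of_subset]) auto

lemma support_in_sum:
  assumes "finite A" and "\<And>a. a \<in> A \<Longrightarrow> support_in X (f a) \<subseteq> W"
  shows "support_in X (\<lambda>x. \<Sum>a\<in>A. f a x) \<subseteq> W"
proof -
  have "{x \<in> topspace X. (\<Sum>a\<in>A. f a x) \<noteq> 0} \<subseteq> \<Union>((\<lambda>a. {x \<in> topspace X. f a x \<noteq> 0}) ` A)"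
    by (auto dest: sum.not_neutral_contains_not_neutral)
  then have "support_in X (\<lambda>x. \<Sum>a\<in>A. f a x) \<subseteq>
      X closure_of (\<Union>((\<lambda>a. {x \<in> topspace X. f a x \<noteq> 0}) ` A))"
    unfolding support_in_def by (rule closure_of_mono)
  also have "\<dots> = (\<Union>a\<in>A. support_in X (f a))"
    using assms(1) by (simp add: closure_of_Union support_in_def image_image)
  finally show ?thesis
    using assms(2) by blast
qed

lemma partition_of_unity_normalize:
  assumes C: "germ_defined_algebra X C" and cover: "locally_finite_open_cover X I U"
    and g: "\<And>i. i \<in> I \<Longrightarrow> g i \<in> C" and nonneg: "\<And>i x. i \<in> I \<Longrightarrow> x \<in> topspace X \<Longrightarrow> 0 \<le> g i x"
    and supp: "\<And>i. i \<in> I \<Longrightarrow> support_in X (g i) \<subseteq> U i"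
    and pos: "\<And>x. x \<in> topspace X \<Longrightarrow> \<exists>i\<in>I. 0 < g i x"
  shows "\<exists>f. (\<forall>i\<in>I. f i \<in> C) \<and> partition_of_unity X I f \<and> (\<forall>i\<in>I. support_in X (f i) \<subseteq> U i)"
proof -
  \<comment> \<open>The index set depends on x because a sum over an infinite set is 0 by
    convention. Near a point it can be replaced by the fixed finite set of those i whose
    \<open>U i\<close> meets a neighbourhood, which puts \<open>s\<close> into
    \<open>C\<close>.\<close>
  define s where "s x = (\<Sum>i\<in>{i \<in> I. g i x \<noteq> 0}. g i x)" for x
  define f where "f i x = g i x * inverse (s x)" for i x
  have locfin: "\<exists>V. openin X V \<and> x \<in> V \<and> finite {i \<in> I. U i \<inter> V \<noteq> {}} \<and>
      (\<forall>y\<in>V. {i \<in> I. g i y \<noteq> 0} \<subseteq> {i \<in> I. U i \<inter> V \<noteq> {}})" if x: "x \<in> topspace X" for x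
  proof -
    obtain V where V: "openin X V" "x \<in> V" "finite {i \<in> I. U i \<inter> V \<noteq> {}}"
      using cover x unfolding locally_finite_open_cover_def by meson
    have "y \<in> U i" if "y \<in> V" "i \<in> I" "g i y \<noteq> 0" for y i
    proof -
      have "y \<in> topspace X"
        using openin_subset[OF V(1)] that(1) by blast
      then show ?thesis
        using support_in_superset[of y X "g i"] supp that by blast
    qed
    with V show ?thesis
      by (intro exI[of _ V]) blast
  qed
  have fin: "finite {i \<in> I. g i x \<noteq> 0}" if "x \<in> topspace X" for x
    using locfin[OF that] finite_subset by meson
  have s_pos: "0 < s x" if x: "x \<in> topspace X" for x
  proof -
    obtain i where "i \<in> I" "0 < g i x"
      using pos[OF x] by blast
    then show ?thesis
      unfolding s_def using fin[OF x] nonneg x by (intro sum_pos2[of _ i]) auto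
  qed
  have "s \<in> C"
  proof (rule germ_defined_algebra_local[OF C])
    fix x assume "x \<in> topspace X"
    then obtain V where V: "openin X V" "x \<in> V" "finite {i \<in> I. U i \<inter> V \<noteq> {}}"
      "\<forall>y\<in>V. {i \<in> I. g i y \<noteq> 0} \<subseteq> {i \<in> I. U i \<inter> V \<noteq> {}}"
      using locfin by meson
    have "s y = (\<Sum>i\<in>{i \<in> I. U i \<inter> V \<noteq> {}}. g i y)" if "y \<in> V" for y
      unfolding s_def using V(3) V(4)[rule_format, OF that] by (intro sum.mono_neutral_left) auto
    moreover have "(\<lambda>y. \<Sum>i\<in>{i \<in> I. U i \<inter> V \<noteq> {}}. g i y) \<in> C"
      using g by (intro germ_defined_algebra_sum[OF C]) simp
    ultimately show "\<exists>W h. openin X W \<and> x \<in> W \<and> h \<in> C \<and> (\<forall>y\<in>W. s y = h y)"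
      using V(1,2) by blast
  qed
  then have "(\<lambda>x. inverse (s x)) \<in> C"
    using s_pos by (rule germ_defined_algebra_inverse[OF C])
  then have f_C: "f i \<in> C" if "i \<in> I" for i
    unfolding f_def using germ_defined_algebra_mult[OF C g[OF that]] by blast
  have f_0_iff: "f i x = 0 \<longleftrightarrow> g i x = 0" if "x \<in> topspace X" for i x
    using s_pos[OF that] by (simp add: f_def)
  have "partition_of_unity X I f"
    unfolding partition_of_unity_def
  proof (intro conjI ballI)
    show "continuous_map X euclideanreal (f i)" if "i \<in> I" for i
      using C f_C[OF that] by (rule germ_defined_algebra_continuous)
    show "0 \<le> f i x" if "i \<in> I" "x \<in> topspace X" for i x
      using nonneg[OF that] s_pos[OF that(2)] by (simp add: f_def)
    show "f i x \<le> 1" if "i \<in> I" "x \<in> topspace X" for i x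
    proof -
      have "g i x \<le> s x"
      proof (cases "g i x = 0")
        case False
        then show ?thesis
          unfolding s_def using that fin nonneg by (intro member_le_sum) auto
      qed (use s_pos[OF that(2)] in simp)
      then show ?thesis
        using s_pos[OF that(2)] by (simp add: f_def field_simps)
    qed
    show "\<exists>V. openin X V \<and> x \<in> V \<and> finite {i \<in> I. \<exists>y\<in>V. f i y \<noteq> 0}" if x: "x \<in> topspace X" for x
    proof -
      obtain V where V: "openin X V" "x \<in> V" "finite {i \<in> I. U i \<inter> V \<noteq> {}}"
        "\<forall>y\<in>V. {i \<in> I. g i y \<noteq> 0} \<subseteq> {i \<in> I. U i \<inter> V \<noteq> {}}"
        using locfin[OF x] by meson
      have "{i \<in> I. \<exists>y\<in>V. f i y \<noteq> 0} \<subseteq> {i \<in> I. U i \<inter> V \<noteq> {}}"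
        using V(4) by (fastforce simp: f_def)
      then show ?thesis
        using V(1-3) finite_subset by blast
    qed
    show "(\<Sum>i\<in>{i \<in> I. f i x \<noteq> 0}. f i x) = 1" if "x \<in> topspace X" for x
      using s_pos[OF that] unfolding f_0_iff[OF that] unfolding f_def sum_distrib_right[symmetric]
      by (simp flip: s_def)
  qed
  moreover have "support_in X (f i) \<subseteq> U i" if "i \<in> I" for i
  proof -
    have "support_in X (f i) = support_in X (g i)"
      unfolding support_in_def using f_0_iff by (metis (mono_tags, lifting))
    then show ?thesis
      using supp[OF that] by simp
  qed
  ultimately show ?thesis
    using f_C by blast
qed

section \<open>From bump functions to a partition of unity\<close>

lemma partition_of_unity_if_bump_functions:
  assumes C: "germ_defined_algebra X C" and bump: "has_bump_functions X C"
    and reg: "regular_space X"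
    and cover: "locally_finite_open_cover X I U"
    and compact: "\<And>i. i \<in> I \<Longrightarrow> compactin X (X closure_of U i)"
  shows "\<exists>f. (\<forall>i\<in>I. f i \<in> C) \<and> partition_of_unity X I f \<and> (\<forall>i\<in>I. support_in X (f i) \<subseteq> U i)"
proof -
  have U: "\<And>i. i \<in> I \<Longrightarrow> openin X (U i)" "(\<Union>i\<in>I. U i) = topspace X"
    using cover by (simp_all add: locally_finite_open_cover_def)
  have "\<exists>i b. i \<in> I \<and> x \<in> U i \<and> b \<in> C \<and> (\<forall>y\<in>topspace X. 0 \<le> b y) \<and> 0 < b x \<and>
      support_in X b \<subseteq> U i" if x: "x \<in> topspace X" for x
  proof -
    obtain i where "i \<in> I" "x \<in> U i"
      using U(2) x by blast
    moreover from this obtain f where "f \<in> C" "\<And>y. y \<in> topspace X \<Longrightarrow> 0 \<le> f y" "0 < f x"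
      "support_in X f \<subseteq> U i"
      using bump_function_support[OF bump reg U(1)] by blast
    ultimately show ?thesis
      by blast
  qed
  then obtain idx b where "\<And>x. x \<in> topspace X \<Longrightarrow> idx x \<in> I \<and> x \<in> U (idx x) \<and> b x \<in> C \<and>
      (\<forall>y\<in>topspace X. 0 \<le> b x y) \<and> 0 < b x x \<and> support_in X (b x) \<subseteq> U (idx x)"
    by metis
  then have idx: "\<And>x. x \<in> topspace X \<Longrightarrow> idx x \<in> I" "\<And>x. x \<in> topspace X \<Longrightarrow> x \<in> U (idx x)"
    and b: "\<And>x. x \<in> topspace X \<Longrightarrow> b x \<in> C" "\<And>x y. x \<in> topspace X \<Longrightarrow> y \<in> topspace X \<Longrightarrow> 0 \<le> b x y"
      "\<And>x. x \<in> topspace X \<Longrightarrow> 0 < b x x" "\<And>x. x \<in> topspace X \<Longrightarrow> support_in X (b x) \<subseteq> U (idx x)"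
    by blast+
  \<comment> \<open>Compactness belongs to the closure, so the centres of the bumps are taken there;
    they may lie outside \<open>U i\<close>.\<close>
  have "\<exists>F. finite F \<and> F \<subseteq> X closure_of U i \<and> (\<forall>x\<in>U i. \<exists>y\<in>F. 0 < b y x)" if i: "i \<in> I" for i
  proof -
    let ?K = "X closure_of U i"
    let ?V = "\<lambda>y. {x \<in> topspace X. b y x \<in> {0<..}}"
    have top: "y \<in> topspace X" if "y \<in> ?K" for y
      using that closure_of_subset_topspace[of X "U i"] by blast
    have "openin X (?V y)" if "y \<in> ?K" for y
      using germ_defined_algebra_continuous[OF C b(1)[OF top[OF that]]]
      by (rule openin_continuous_map_preimage) (simp flip: open_openin)
    moreover have "?K \<subseteq> \<Union>(?V ` ?K)"
      using b(3) top by auto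
    ultimately obtain \<F> where \<F>: "finite \<F>" "\<F> \<subseteq> ?V ` ?K" "?K \<subseteq> \<Union>\<F>"
      using compactinD[OF compact[OF i], of "?V ` ?K"] by blast
    obtain F where F: "F \<subseteq> ?K" "finite F" "\<F> = ?V ` F"
      using finite_subset_image[OF \<F>(1,2)] by blast
    moreover have "U i \<subseteq> ?K"
      using U(1)[OF i] by (intro closure_of_subset openin_subset)
    ultimately show ?thesis
      using \<F>(3) by (intro exI[of _ F]) blast
  qed
  then obtain F where F: "\<And>i. i \<in> I \<Longrightarrow> finite (F i)" "\<And>i. i \<in> I \<Longrightarrow> F i \<subseteq> X closure_of U i"
    "\<And>i x. i \<in> I \<Longrightarrow> x \<in> U i \<Longrightarrow> \<exists>y\<in>F i. 0 < b y x"
    by metis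
  \<comment> \<open>A centre is assigned to the set that contains the support of its bump, which
    need not be the set whose closure it helps to cover: a boundary point y of \<open>U i\<close>
    has \<open>idx y \<noteq> i\<close>.\<close>
  define G where "G j = {y \<in> \<Union>(F ` I). idx y = j}" for j
  have "F i \<subseteq> topspace X" if "i \<in> I" for i
    using F(2)[OF that] closure_of_subset_topspace[of X "U i"] by (rule order_trans)
  then have G_top: "y \<in> topspace X" if "y \<in> G j" for y j
    using that unfolding G_def by blast
  have fin: "finite (G j)" if "j \<in> I" for j
  proof -
    \<comment> \<open>A centre in \<open>F i\<close> assigned to j lies in \<open>U j\<close> and in
      the closure of \<open>U i\<close>. So the open set \<open>U j\<close> meets
      \<open>U i\<close>, and \<open>U i\<close> meets the compact closure of \<open>U j\<close>,
      which only finitely many i can do.\<close>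
    let ?N = "{i \<in> I. U i \<inter> X closure_of U j \<noteq> {}}"
    have "G j \<subseteq> \<Union>(F ` ?N)"
    proof
      fix y assume y: "y \<in> G j"
      then obtain i where i: "i \<in> I" "y \<in> F i" "idx y = j"
        by (auto simp: G_def)
      then have "y \<in> X closure_of U i" "y \<in> U j"
        using F(2) idx(2) G_top[OF y] by auto
      then have "U j \<inter> U i \<noteq> {}"
        using openin_Int_closure_of_eq_empty[OF U(1)[OF that], of "U i"] by blast
      moreover have "U j \<subseteq> X closure_of U j"
        using U(1)[OF that] by (intro closure_of_subset openin_subset)
      ultimately show "y \<in> \<Union>(F ` ?N)"
        using i by blast
    qed
    moreover have "finite ?N"
      using cover compact[OF that] by (rule locally_finite_open_cover_finite_meeting_compact)
    ultimately show ?thesis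
      using F(1) by (elim finite_subset) simp
  qed
  define g where "g j x = (\<Sum>y\<in>G j. b y x)" for j x
  show ?thesis
  proof (rule partition_of_unity_normalize[OF C cover])
    show "g j \<in> C" for j
      unfolding g_def using b(1) G_top by (intro germ_defined_algebra_sum[OF C]) blast
    show "0 \<le> g j x" if "x \<in> topspace X" for j x
      unfolding g_def using b(2) G_top that by (intro sum_nonneg) blast
    show "support_in X (g j) \<subseteq> U j" if "j \<in> I" for j
      unfolding g_def
    proof (rule support_in_sum[OF fin[OF that]])
      fix y assume "y \<in> G j"
      then show "support_in X (b y) \<subseteq> U j"
        using b(4)[OF G_top] by (auto simp: G_def)
    qed
    show "\<exists>j\<in>I. 0 < g j x" if x: "x \<in> topspace X" for x
    proof -
      obtain i where "i \<in> I" "x \<in> U i"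
        using U(2) x by blast
      then obtain y where y: "y \<in> F i" "0 < b y x"
        using F(3) by blast
      then have yG: "y \<in> G (idx y)"
        using \<open>i \<in> I\<close> by (auto simp: G_def)
      have j: "idx y \<in> I"
        using idx(1) G_top[OF yG] .
      have "0 < g (idx y) x"
        unfolding g_def using fin[OF j] yG y(2) b(2)[OF G_top x] by (intro sum_pos2[of _ y])
      with j show ?thesis
        by blast
    qed
  qed
qed

theorem proposition2p8:
  fixes X :: "'a decomposition" and C :: "('a \<Rightarrow> real) set"
    and I :: "'i set" and U :: "'i \<Rightarrow> 'a set"
  assumes "stratified_space X"
    and "smooth_structure X C"
    and "locally_finite_open_cover (top_of X) I U"
    and "\<forall>i\<in>I. compactin (top_of X) (top_of X closure_of U i)"
  shows "\<exists>f. (\<forall>i\<in>I. f i \<in> C) \<and> partition_of_unity (top_of X) I f \<and>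
             (\<forall>i\<in>I. support_in (top_of X) (f i) \<subseteq> U i)"
proof (rule partition_of_unity_if_bump_functions)
  \<comment> \<open>The closures of the covering sets serve as compact neighbourhoods; together with
    the Hausdorff property this yields regularity.\<close>
  have "locally_compact_space (top_of X)"
    unfolding locally_compact_space_def
  proof
    fix x assume "x \<in> topspace (top_of X)"
    moreover have "\<forall>i\<in>I. openin (top_of X) (U i)" "(\<Union>i\<in>I. U i) = topspace (top_of X)"
      using assms(3) by (simp_all add: locally_finite_open_cover_def)
    ultimately obtain i where i: "i \<in> I" "x \<in> U i" "openin (top_of X) (U i)"
      by blast
    then have "U i \<subseteq> top_of X closure_of U i"
      by (intro closure_of_subset openin_subset)
    with i show "\<exists>V K. openin (top_of X) V \<and> compactin (top_of X) K \<and> x \<in> V \<and> V \<subseteq> K"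
      using assms(4) by blast
  qed
  moreover have "Hausdorff_space (top_of X)"
    using stratified_space_imp_decomposed_space[OF assms(1)] by (simp add: decomposed_space_def)
  ultimately show reg: "regular_space (top_of X)"
    by (rule locally_compact_Hausdorff_imp_regular_space)
  show "germ_defined_algebra (top_of X) C"
    using assms(2) by (cases rule: smooth_structure.cases)
  show "has_bump_functions (top_of X) C"
    using assms(2) reg by (rule smooth_structure_has_bump_functions)
qed (use assms(3,4) in auto)

end
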